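(* There exists an absolute constant $C>0$ such that the following holds. Let $u$ be a linear operator on $\ell_2$ with $\|u\|=1$ and $h=\|u\|_{HS}^2<\infty$. Then for every integer $n>1$ there exists a diagonal operator $\Delta$ on $\ell_2$ such that $\operatorname{rank}\Delta\le n$ and $$\|u(\Delta-\mathrm{id})u^*\|\le C\sqrt{\log n}\cdot\sqrt{\frac{h}{n}}.$$
   Context: $\|\cdot\|$ is the operator norm, $\|u\|_{HS}=\big(\sum_j\|ue_j\|^2\big)^{1/2}$ is the Hilbert–Schmidt norm, where $(e_j)$ is the canonical basis of $\ell_2$. "Diagonal" means diagonal with respect to $(e_j)$; $\mathrm{id}$ is the identity operator. *)

theory Defs
  imports "HOL-Analysis.Analysis" "HOL-Library.Extended_Nat"
begin

(* A uniform treatment of the scalar fields of real and complex Hilbert spaces. *)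

class conj_field = real_normed_field +
  fixes conjugate :: "'a \<Rightarrow> 'a"
  assumes conjugate_add: "conjugate (x + y) = conjugate x + conjugate y"
    and conjugate_mult: "conjugate (x * y) = conjugate x * conjugate y"
    and mult_conjugate: "x * conjugate x = (norm x)\<^sup>2 *\<^sub>R 1"

instantiation real :: conj_field
begin
definition conjugate_real :: "real \<Rightarrow> real" where "conjugate_real x = x"
instance by standard (simp_all add: conjugate_real_def power2_eq_square)
end

instantiation complex :: conj_field
begin
definition conjugate_complex :: "complex \<Rightarrow> complex" where "conjugate_complex = cnj"
instance
  by standard (simp_all add: conjugate_complex_def scaleR_conv_of_real complex_norm_square del: of_real_power)
end

typedef (overloaded) 'a ell2 =
  "{x :: nat \<Rightarrow> 'a::real_normed_vector. summable (\<lambda>i. (norm (x i))\<^sup>2)}"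
  by (rule exI[of _ "\<lambda>_. 0"]) simp

setup_lifting type_definition_ell2

lemma square_summable_add:
  fixes x y :: "nat \<Rightarrow> 'a::real_normed_vector"
  assumes "summable (\<lambda>i. (norm (x i))\<^sup>2)" "summable (\<lambda>i. (norm (y i))\<^sup>2)"
  shows "summable (\<lambda>i. (norm (x i + y i))\<^sup>2)"
proof (rule summable_comparison_test')
  show "summable (\<lambda>i. 2 * (norm (x i))\<^sup>2 + 2 * (norm (y i))\<^sup>2)"
    by (intro summable_add summable_mult assms)
  fix i
  have "(norm (x i + y i))\<^sup>2 \<le> (norm (x i) + norm (y i))\<^sup>2"
    by (intro power_mono norm_triangle_ineq) simp
  also have "\<dots> \<le> 2 * (norm (x i))\<^sup>2 + 2 * (norm (y i))\<^sup>2"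
    using sum_squares_bound[of "norm (x i)" "norm (y i)"] by (simp add: power2_sum)
  finally show "norm ((norm (x i + y i))\<^sup>2) \<le> 2 * (norm (x i))\<^sup>2 + 2 * (norm (y i))\<^sup>2"
    by simp
qed

instantiation ell2 :: (real_normed_vector) real_vector
begin

lift_definition zero_ell2 :: "'a ell2" is "\<lambda>_. 0" by simp

lift_definition uminus_ell2 :: "'a ell2 \<Rightarrow> 'a ell2" is "\<lambda>x i. - x i" by simp

lift_definition plus_ell2 :: "'a ell2 \<Rightarrow> 'a ell2 \<Rightarrow> 'a ell2" is "\<lambda>x y i. x i + y i"
  by (rule square_summable_add)

lift_definition minus_ell2 :: "'a ell2 \<Rightarrow> 'a ell2 \<Rightarrow> 'a ell2" is "\<lambda>x y i. x i - y i"
  subgoal for x y using square_summable_add[of x "\<lambda>i. - y i"] by simp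
  done

lift_definition scaleR_ell2 :: "real \<Rightarrow> 'a ell2 \<Rightarrow> 'a ell2" is "\<lambda>r x i. r *\<^sub>R x i"
  by (simp add: power_mult_distrib summable_mult)

instance
  by standard (transfer; simp add: algebra_simps fun_eq_iff)+

end

instantiation ell2 :: (real_normed_vector) real_normed_vector
begin

lift_definition norm_ell2 :: "'a ell2 \<Rightarrow> real" is "\<lambda>x. sqrt (\<Sum>i. (norm (x i))\<^sup>2)" .

definition "dist (x :: 'a ell2) y = norm (x - y)"
definition "sgn (x :: 'a ell2) = x /\<^sub>R norm x"
definition "(uniformity :: ('a ell2 \<times> 'a ell2) filter) =
  (INF e\<in>{0 <..}. principal {(x, y). dist x y < e})"
definition "open (U :: 'a ell2 set) \<longleftrightarrow>
  (\<forall>x\<in>U. eventually (\<lambda>(x', y). x' = x \<longrightarrow> y \<in> U) uniformity)"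

instance
proof
  fix x y :: "'a ell2" and r :: real and U :: "'a ell2 set"
  show "dist x y = norm (x - y)" by (rule dist_ell2_def)
  show "sgn x = x /\<^sub>R norm x" by (rule sgn_ell2_def)
  show "(uniformity :: ('a ell2 \<times> 'a ell2) filter) =
    (INF e\<in>{0 <..}. principal {(x, y). dist x y < e})" by (rule uniformity_ell2_def)
  show "open U \<longleftrightarrow> (\<forall>x\<in>U. eventually (\<lambda>(x', y). x' = x \<longrightarrow> y \<in> U) uniformity)"
    by (rule open_ell2_def)
  show "norm x = 0 \<longleftrightarrow> x = 0"
    by transfer (simp add: suminf_eq_zero_iff fun_eq_iff)
  show "norm (r *\<^sub>R x) = \<bar>r\<bar> * norm x"
    by transfer (simp add: power_mult_distrib suminf_mult real_sqrt_mult)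
  show "norm (x + y) \<le> norm x + norm y"
  proof transfer
    fix x y :: "nat \<Rightarrow> 'a"
    assume x: "summable (\<lambda>i. (norm (x i))\<^sup>2)" and y: "summable (\<lambda>i. (norm (y i))\<^sup>2)"
    let ?S = "\<lambda>z::nat \<Rightarrow> 'a. sqrt (\<Sum>i. (norm (z i))\<^sup>2)"
    have nonneg: "0 \<le> ?S x + ?S y" by (simp add: suminf_nonneg x y)
    have part: "L2_set (\<lambda>i. norm (z i)) {..<n} \<le> ?S z"
      if "summable (\<lambda>i. (norm (z i))\<^sup>2)" for z :: "nat \<Rightarrow> 'a" and n
      unfolding L2_set_def using that by (auto intro!: sum_le_suminf)
    have "(\<Sum>i<n. (norm (x i + y i))\<^sup>2) \<le> (?S x + ?S y)\<^sup>2" for n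
    proof -
      have "sqrt (\<Sum>i<n. (norm (x i + y i))\<^sup>2) = L2_set (\<lambda>i. norm (x i + y i)) {..<n}"
        by (simp add: L2_set_def)
      also have "\<dots> \<le> L2_set (\<lambda>i. norm (x i) + norm (y i)) {..<n}"
        by (intro L2_set_mono norm_triangle_ineq) simp
      also have "\<dots> \<le> L2_set (\<lambda>i. norm (x i)) {..<n} + L2_set (\<lambda>i. norm (y i)) {..<n}"
        by (rule L2_set_triangle_ineq)
      also have "\<dots> \<le> ?S x + ?S y" by (intro add_mono part x y)
      finally show ?thesis using sqrt_le_D by blast
    qed
    then have "(\<Sum>i. (norm (x i + y i))\<^sup>2) \<le> (?S x + ?S y)\<^sup>2"
      by (intro suminf_le_const square_summable_add x y)
    then show "?S (\<lambda>i. x i + y i) \<le> ?S x + ?S y"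
      using nonneg by (rule real_le_lsqrt[rotated])
  qed
qed

end

(* Multiplication by a scalar of the field itself, e.g. by complex numbers on complex ell2. *)
lift_definition ell2_scale :: "'a::real_normed_field \<Rightarrow> 'a ell2 \<Rightarrow> 'a ell2"
  is "\<lambda>c x i. c * x i"
  by (simp add: norm_mult power_mult_distrib summable_mult)

global_interpretation ell2: vector_space "ell2_scale :: 'a::real_normed_field \<Rightarrow> _"
  by standard (transfer; simp add: algebra_simps fun_eq_iff)+

lift_definition ell2_basis :: "nat \<Rightarrow> 'a::real_normed_field ell2"
  is "\<lambda>j i. if i = j then 1 else 0"
  subgoal for j by (rule summable_finite[of "{j}"]) auto
  done

lift_definition ell2_inner :: "'a::conj_field ell2 \<Rightarrow> 'a ell2 \<Rightarrow> 'a"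
  is "\<lambda>x y. \<Sum>i. x i * conjugate (y i)" .

definition bounded_op :: "('a::real_normed_field ell2 \<Rightarrow> 'a ell2) \<Rightarrow> bool" where
  "bounded_op u \<longleftrightarrow>
     Vector_Spaces.linear ell2_scale ell2_scale u \<and> (\<exists>K. \<forall>x. norm (u x) \<le> K * norm x)"

lemma bounded_op_imp_bounded_linear:
  assumes "bounded_op u"
  shows "bounded_linear u"
proof -
  obtain K where K: "\<And>x. norm (u x) \<le> K * norm x"
    and lin: "Vector_Spaces.linear ell2_scale ell2_scale u"
    using assms unfolding bounded_op_def by blast
  interpret u: Vector_Spaces.linear ell2_scale ell2_scale u by (rule lin)
  have scaleR: "r *\<^sub>R x = ell2_scale (of_real r) x" for r and x :: "'a ell2"
    by transfer (simp add: scaleR_conv_of_real)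
  show ?thesis
    by (rule bounded_linear_intro[of _ K])
      (use K in \<open>simp_all add: u.add u.scale scaleR mult.commute\<close>)
qed

definition ell2_adjoint ::
    "('a::conj_field ell2 \<Rightarrow> 'a ell2) \<Rightarrow> 'a ell2 \<Rightarrow> 'a ell2" where
  "ell2_adjoint u = (THE v. \<forall>x y. ell2_inner (u x) y = ell2_inner x (v y))"

definition hilbert_schmidt :: "('a::real_normed_field ell2 \<Rightarrow> 'a ell2) \<Rightarrow> bool" where
  "hilbert_schmidt u \<longleftrightarrow> summable (\<lambda>j. (norm (u (ell2_basis j)))\<^sup>2)"

(* Meaningful only under hilbert_schmidt: suminf is unspecified on divergent series. *)
definition hs_norm :: "('a::real_normed_field ell2 \<Rightarrow> 'a ell2) \<Rightarrow> real" where
  "hs_norm u = sqrt (\<Sum>j. (norm (u (ell2_basis j)))\<^sup>2)"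

definition diagonal_op :: "('a::real_normed_field ell2 \<Rightarrow> 'a ell2) \<Rightarrow> bool" where
  "diagonal_op d \<longleftrightarrow>
     bounded_op d \<and> (\<forall>j. \<exists>c. d (ell2_basis j) = ell2_scale c (ell2_basis j))"

(* The library dimension of an infinite-dimensional space is 0, hence the case distinction. *)
definition op_rank :: "('a::real_normed_field ell2 \<Rightarrow> 'a ell2) \<Rightarrow> enat" where
  "op_rank u =
     (if \<exists>B. finite B \<and> ell2.span B = range u then enat (ell2.dim (range u)) else \<infinity>)"

end

theory Submission
  imports Defs
begin

text \<open>
  Put $x_j = ue_j$. For a real diagonal operator $\Delta$ with entries $w_j$ the operator
  $u(\Delta - \mathrm{id})u^*$ is Hermitian with quadratic form $\sum_j (w_j - 1)|\langle z,x_j\rangle|^2$, so the task is to find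
  weights with at most $n$ nonzero entries for which this form is small. Here $\sum_j x_jx_j^* = uu^*$ has norm at most $1$ and
  trace $h$. The proof is deterministic and in the spirit of the barrier method of Batson, Spielman and
  Srivastava.

  The heart is a partial colouring lemma (\<open>partial_colouring\<close>). Let $m$ vectors $y_i$ be given with $\sum_i \|y_i\|^2 \le H$.
  Signs $e_i = \pm 1$ are assigned to half of them, one after the other, so that
  $c + \sum_i (g|e_i| \mp e_i)\,y_iy_i^*$ remain positive, where the drift $g$ pays for the variance of the signs. Every step is a rank-one
  update, so the inverses $B_1$, $B_2$ of these two operators are given by the Sherman-Morrison formula (\<open>sherman_morrison\<close>).
  The potential $\sum_i \langle B_1y_i,y_i\rangle + \sum_i \langle B_2y_i,y_i\rangle$ can be kept from growing as long as the vector $y$ to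
  be coloured has $\langle B_1y,y\rangle$ and $\langle B_2y,y\rangle$ at most $g$ (\<open>choose_sign\<close>), and by averaging such a vector
  exists while half of the vectors are left. With $c = g = 2\sqrt{H/m}$ positivity at the end means
  $|\sum_i e_i|\langle z,y_i\rangle|^2| \le g(1 + K)\|z\|^2$, where $K$ is the norm of $\sum_i y_iy_i^*$.

  Multiplying the weights by $1 + e_i$ kills at least a quarter of them at the price of an error of order
  $\sqrt{H/m}$. Repeating this until at most $n$ weights remain, the errors form a geometric series dominated by its
  last term, of order $\sqrt{h/n}$ (\<open>iterated_thinning\<close>, \<open>sparse_weights\<close>); an extra coordinate keeps the trace $H$ under control
  during the iteration. Truncating the sequence $x_j$ reduces the problem to finitely many vectors, and
  since $\ln n \ge \ln 2$ for $n > 1$ the resulting bound $301\sqrt{h/n}$ (\<open>diagonal_sparsification\<close>) implies the theorem, for real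
  and complex scalars alike.
\<close>

section \<open>Scalars with a conjugation\<close>

lemma conjugate_zero [simp]: "conjugate (0::'a::conj_field) = 0"
  using conjugate_add[of "0::'a" 0] by simp

lemma conjugate_minus [simp]: "conjugate (- x) = - conjugate (x::'a::conj_field)"
  using conjugate_add[of x "- x"] by (simp add: eq_neg_iff_add_eq_0 add.commute)

lemma mult_conjugate_of_real: "x * conjugate x = of_real ((norm x)\<^sup>2)" for x :: "'a::conj_field"
  unfolding mult_conjugate by (simp only: of_real_def)

lemma conjugate_of_real [simp]: "conjugate (of_real r) = (of_real r :: 'a::conj_field)"
proof (cases "r = 0")
  case False
  have "of_real r * conjugate (of_real r) = (of_real r * of_real r :: 'a)"
    unfolding mult_conjugate_of_real by (simp add: power2_eq_square)
  then show ?thesis using False by simp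
qed simp

lemma conjugate_one [simp]: "conjugate (1::'a::conj_field) = 1"
  using conjugate_of_real[of 1] by simp

lemma norm_conjugate [simp]: "norm (conjugate x) = norm (x::'a::conj_field)"
proof (cases "x = 0")
  case False
  have "norm (x * conjugate x) = (norm x)\<^sup>2"
    unfolding mult_conjugate_of_real by (simp del: of_real_power)
  then show ?thesis using False by (simp add: norm_mult power2_eq_square)
qed simp

lemma conjugate_conjugate [simp]: "conjugate (conjugate x) = (x::'a::conj_field)"
proof (cases "x = 0")
  case False
  have "conjugate x * conjugate (conjugate x) = conjugate x * x"
    using mult_conjugate_of_real[of x] mult_conjugate_of_real[of "conjugate x"]
    by (simp add: mult.commute)
  moreover have "conjugate x \<noteq> 0" using False norm_conjugate[of x] by (metis norm_eq_zero)
  ultimately show ?thesis by simp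
qed simp

lemma bounded_linear_conjugate: "bounded_linear (conjugate :: 'a::conj_field \<Rightarrow> 'a)"
  by (rule bounded_linear_intro[of _ 1])
    (simp_all add: conjugate_add conjugate_mult scaleR_conv_of_real)

text \<open>
  By polarization $|1+c|^2 = 1 + |c|^2 + c + \bar c$, so
  $c + \bar c$ is a real scalar, and this is twice the real part; the formula makes sense uniformly
  for real and complex scalars.
\<close>

definition re_part :: "'a::conj_field \<Rightarrow> real" where
  "re_part c = ((norm (1 + c))\<^sup>2 - 1 - (norm c)\<^sup>2) / 2"

lemma of_real_re_part: "of_real (2 * re_part c) = c + conjugate (c::'a::conj_field)"
proof -
  have "of_real (2 * re_part c) = (of_real ((norm (1 + c))\<^sup>2) - 1 - of_real ((norm c)\<^sup>2) :: 'a)"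
    by (simp add: re_part_def)
  also have "\<dots> = c + conjugate c"
    unfolding mult_conjugate_of_real[symmetric] by (simp add: conjugate_add algebra_simps)
  finally show ?thesis .
qed

lemma re_part_eqI: "c + conjugate c = of_real (2 * r) \<Longrightarrow> re_part (c::'a::conj_field) = r"
  unfolding of_real_re_part[symmetric] of_real_eq_iff by simp

lemma re_part_add: "re_part (c + d) = re_part c + re_part (d::'a::conj_field)"
  by (rule re_part_eqI) (simp only: of_real_re_part conjugate_add distrib_left of_real_add; simp add: algebra_simps)

lemma re_part_minus: "re_part (- c) = - re_part (c::'a::conj_field)"
  by (rule re_part_eqI) (simp only: of_real_re_part conjugate_minus mult_minus_right of_real_minus; simp)

lemma re_part_diff: "re_part (c - d) = re_part c - re_part (d::'a::conj_field)"
  using re_part_add[of c "- d"] by (simp add: re_part_minus)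

lemma re_part_of_real [simp]: "re_part (of_real r :: 'a::conj_field) = r"
  by (rule re_part_eqI) simp

lemma re_part_zero [simp]: "re_part (0 :: 'a::conj_field) = 0"
  using re_part_of_real[of 0] by simp

lemma re_part_of_real_mult: "re_part (of_real r * c) = r * re_part (c::'a::conj_field)"
proof (rule re_part_eqI)
  have "of_real r * c + conjugate (of_real r * c) = of_real r * (c + conjugate c)"
    by (simp add: conjugate_mult algebra_simps)
  also have "\<dots> = of_real (2 * (r * re_part c))"
    unfolding of_real_re_part[symmetric] by simp
  finally show "of_real r * c + conjugate (of_real r * c) = of_real (2 * (r * re_part c))" .
qed

lemma re_part_conjugate [simp]: "re_part (conjugate c) = re_part (c::'a::conj_field)"
  by (rule re_part_eqI) (simp only: of_real_re_part conjugate_conjugate; simp add: add.commute)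

lemma re_part_mult_conjugate: "re_part (c * conjugate c) = (norm (c::'a::conj_field))\<^sup>2"
  unfolding mult_conjugate_of_real by (rule re_part_of_real)

lemma re_part_sum: "re_part (sum f A) = (\<Sum>i\<in>A. re_part (f i :: 'a::conj_field))"
  by (induction A rule: infinite_finite_induct) (simp_all add: re_part_add)

lemma of_real_re_part_hermitian: "conjugate c = c \<Longrightarrow> of_real (re_part c) = (c::'a::conj_field)"
  using of_real_re_part[of c] by simp

section \<open>The inner product of square-summable sequences\<close>

abbreviation entry :: "'a::real_normed_vector ell2 \<Rightarrow> nat \<Rightarrow> 'a" where "entry \<equiv> Rep_ell2"

lemma summable_entry: "summable (\<lambda>i. (norm (entry x i))\<^sup>2)"
  using Rep_ell2[of x] by simp

lemma norm_ell2_sq: "(norm x)\<^sup>2 = (\<Sum>i. (norm (entry x i))\<^sup>2)"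
  unfolding norm_ell2.rep_eq by (simp add: suminf_nonneg summable_entry)

lemma sum_entry_le: "finite A \<Longrightarrow> (\<Sum>i\<in>A. (norm (entry x i))\<^sup>2) \<le> (norm x)\<^sup>2"
  unfolding norm_ell2_sq by (rule sum_le_suminf) (auto simp: summable_entry)

lemma sums_entries_le: "(\<Sum>i<n. norm (entry x i) * norm (entry y i)) \<le> norm x * norm y"
proof -
  have "(\<Sum>i<n. norm (entry x i) * norm (entry y i))
      \<le> L2_set (\<lambda>i. norm (entry x i)) {..<n} * L2_set (\<lambda>i. norm (entry y i)) {..<n}"
    using L2_set_mult_ineq[of "\<lambda>i. norm (entry x i)" "\<lambda>i. norm (entry y i)" "{..<n}"] by simp
  also have "\<dots> \<le> norm x * norm y"
    unfolding L2_set_def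
    by (intro mult_mono real_le_lsqrt sum_entry_le) (auto intro: sum_nonneg)
  finally show ?thesis .
qed

lemma summable_entries: "summable (\<lambda>i. norm (entry x i) * norm (entry y i))"
proof (rule bounded_imp_summable)
  show "(\<Sum>i\<le>n. norm (entry x i) * norm (entry y i)) \<le> norm x * norm y" for n
    unfolding lessThan_Suc_atMost[symmetric] by (rule sums_entries_le)
qed simp

lemma summable_ell2_inner:
  fixes x y :: "'a::{conj_field,banach} ell2"
  shows "summable (\<lambda>i. entry x i * conjugate (entry y i))"
  by (rule summable_norm_cancel) (simp add: norm_mult summable_entries)

lemma ell2_inner_rep: "ell2_inner x y = (\<Sum>i. entry x i * conjugate (entry y i))"
  by (simp add: ell2_inner.rep_eq)

lemma ell2_inner_add_left: "ell2_inner (x + y) z = ell2_inner x z + ell2_inner y (z::'a::{conj_field,banach} ell2)"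
  by (simp add: ell2_inner_rep plus_ell2.rep_eq distrib_right suminf_add summable_ell2_inner)

lemma ell2_inner_scale_left: "ell2_inner (ell2_scale c x) y = c * ell2_inner x (y::'a::{conj_field,banach} ell2)"
  by (simp add: ell2_inner_rep ell2_scale.rep_eq mult.assoc suminf_mult summable_ell2_inner)

lemma conjugate_ell2_inner: "conjugate (ell2_inner x y) = ell2_inner y (x::'a::{conj_field,banach} ell2)"
  unfolding ell2_inner_rep
  using bounded_linear.suminf[OF bounded_linear_conjugate summable_ell2_inner, of x y]
  by (simp add: conjugate_mult mult.commute)

lemma ell2_inner_add_right: "ell2_inner z (x + y) = ell2_inner z x + ell2_inner (z::'a::{conj_field,banach} ell2) y"
  using arg_cong[OF ell2_inner_add_left[of x y z], of conjugate]
  by (simp only: conjugate_add conjugate_ell2_inner)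

lemma ell2_inner_scale_right: "ell2_inner x (ell2_scale c y) = conjugate c * ell2_inner x (y::'a::{conj_field,banach} ell2)"
  using arg_cong[OF ell2_inner_scale_left[of c y x], of conjugate]
  by (simp only: conjugate_mult conjugate_ell2_inner)

lemma ell2_inner_minus_left: "ell2_inner (- x) y = - ell2_inner x (y::'a::{conj_field,banach} ell2)"
  using ell2_inner_scale_left[of "- 1" x y] by simp

lemma ell2_inner_minus_right: "ell2_inner x (- y) = - ell2_inner x (y::'a::{conj_field,banach} ell2)"
  using ell2_inner_scale_right[of x "- 1" y] by simp

lemma ell2_inner_diff_left: "ell2_inner (x - y) z = ell2_inner x z - ell2_inner y (z::'a::{conj_field,banach} ell2)"
  using ell2_inner_add_left[of x "- y" z] by (simp add: ell2_inner_minus_left)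

lemma ell2_inner_diff_right: "ell2_inner z (x - y) = ell2_inner z x - ell2_inner (z::'a::{conj_field,banach} ell2) y"
  using ell2_inner_add_right[of z x "- y"] by (simp add: ell2_inner_minus_right)

lemma ell2_inner_zero_left [simp]: "ell2_inner 0 (x::'a::{conj_field,banach} ell2) = 0"
  using ell2_inner_add_left[of 0 0 x] by simp

lemma ell2_inner_zero_right [simp]: "ell2_inner x (0::'a::{conj_field,banach} ell2) = 0"
  using ell2_inner_add_right[of x 0 0] by simp

lemma ell2_inner_sum_left:
  fixes y :: "'a::{conj_field,banach} ell2"
  shows "ell2_inner (sum f A) y = (\<Sum>i\<in>A. ell2_inner (f i) y)"
  by (induction A rule: infinite_finite_induct) (simp_all add: ell2_inner_add_left)

lemma ell2_inner_self: "ell2_inner x x = (of_real ((norm x)\<^sup>2) :: 'a::{conj_field,banach})"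
  using suminf_of_real[OF summable_entry[of x], where 'a = 'a]
  by (simp only: ell2_inner_rep mult_conjugate_of_real norm_ell2_sq)

lemma norm_ell2_inner_le: "norm (ell2_inner x y) \<le> norm x * norm (y::'a::{conj_field,banach} ell2)"
proof -
  have "norm (ell2_inner x y) \<le> (\<Sum>i. norm (entry x i) * norm (entry y i))"
    unfolding ell2_inner_rep using summable_norm[of "\<lambda>i. entry x i * conjugate (entry y i)"] summable_entries[of x y]
    by (simp add: norm_mult)
  also have "\<dots> \<le> norm x * norm y"
    by (rule suminf_le_const[OF summable_entries sums_entries_le])
  finally show ?thesis .
qed

lemma norm_ell2_scale: "norm (ell2_scale c x) = norm c * norm x"
  by transfer (simp add: norm_mult power_mult_distrib suminf_mult real_sqrt_mult)

lemma entry_basis: "entry (ell2_basis j) i = (if i = j then 1 else 0)"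
  by (simp add: ell2_basis.rep_eq)

lemma ell2_inner_basis_left: "ell2_inner (ell2_basis j) y = conjugate (entry (y::'a::{conj_field,banach} ell2) j)"
proof -
  have "ell2_inner (ell2_basis j) y = (\<Sum>i\<in>{j}. entry (ell2_basis j) i * conjugate (entry y i))"
    unfolding ell2_inner_rep by (rule suminf_finite) (auto simp: entry_basis)
  then show ?thesis by (simp add: entry_basis)
qed

lemma ell2_eqI: "(\<And>i. entry x i = entry y i) \<Longrightarrow> x = y"
  by (simp add: Rep_ell2_inject[symmetric] fun_eq_iff)

lemma entry_sum: "entry (sum f A) i = (\<Sum>k\<in>A. entry (f k) i)"
  by (induction A rule: infinite_finite_induct) (simp_all add: zero_ell2.rep_eq plus_ell2.rep_eq)


lemma entry_truncation:
  fixes x :: "'a::real_normed_field ell2"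
  shows "entry (\<Sum>j<n. ell2_scale (entry x j) (ell2_basis j)) i = (if i < n then entry x i else 0)"
proof -
    have "entry (\<Sum>j<n. ell2_scale (entry x j) (ell2_basis j)) i = (\<Sum>j<n. if j = i then entry x j else 0)"
      unfolding entry_sum by (intro sum.cong) (auto simp: ell2_scale.rep_eq entry_basis)
    then show ?thesis by simp
qed

text \<open>
  This lets a bounded operator on \<open>ell2\<close> be recovered from its values on the basis.
\<close>

lemma truncation_tendsto:
  fixes x :: "'a::real_normed_field ell2"
  shows "(\<lambda>n. \<Sum>j<n. ell2_scale (entry x j) (ell2_basis j)) \<longlonglongrightarrow> x"
proof -
  define t where "t n = (\<Sum>j<n. ell2_scale (entry x j) (ell2_basis j))" for n
  have ent: "entry (t n - x) i = (if i < n then 0 else - entry x i)" for n i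
    by (simp add: t_def entry_truncation minus_ell2.rep_eq)
  have eq: "(norm (t n - x))\<^sup>2 = (\<Sum>i. (norm (entry x (i + n)))\<^sup>2)" for n
    unfolding norm_ell2_sq
    using suminf_split_initial_segment[OF summable_entry, of "t n - x" n] by (simp add: ent)
  have "(\<lambda>n. \<Sum>i. (norm (entry x (i + n)))\<^sup>2) \<longlonglongrightarrow> 0"
    by (rule suminf_exist_split2[OF summable_entry])
  then have "(\<lambda>n. (norm (t n - x))\<^sup>2) \<longlonglongrightarrow> 0" unfolding eq .
  from tendsto_real_sqrt[OF this] have "(\<lambda>n. norm (t n - x)) \<longlonglongrightarrow> 0" by simp
  then show ?thesis unfolding t_def[symmetric] by (rule LIM_zero_cancel[OF tendsto_norm_zero_cancel])
qed

section \<open>Rank-one updates of positive operators\<close>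

text \<open>
  The form of a Hermitian operator takes real values, and the real part turns them into elements of
  an ordered field, whatever the scalars are.
\<close>

definition energy :: "('a::conj_field ell2 \<Rightarrow> 'a ell2) \<Rightarrow> 'a ell2 \<Rightarrow> real" where
  "energy B x = re_part (ell2_inner (B x) x)"

text \<open>
  A left inverse \<open>B\<close> that is Hermitian and positive serves as a certificate of positivity of \<open>R\<close>. It is
  explicit, so no spectral theory or existence theorem for inverses enters, and the space may be
  infinite-dimensional.
\<close>

definition pos_inverse ::
    "('a::conj_field ell2 \<Rightarrow> 'a ell2) \<Rightarrow> ('a ell2 \<Rightarrow> 'a ell2) \<Rightarrow> bool" where
  "pos_inverse R B \<longleftrightarrow>
     Vector_Spaces.linear ell2_scale ell2_scale B \<and> (\<forall>z. B (R z) = z) \<and>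
     (\<forall>x y. ell2_inner (B x) y = ell2_inner x (B y)) \<and> (\<forall>x. 0 \<le> energy B x)"

text \<open>
  Since $z = BRz$, the form of $R$ at $z$ equals the form of $B$ at $Rz$.
\<close>

lemma energy_nonneg_of_pos_inverse:
  fixes R :: "'a::{conj_field,banach} ell2 \<Rightarrow> 'a ell2"
  assumes "pos_inverse R B"
  shows "0 \<le> energy R z"
proof -
  have "0 \<le> energy B (R z)" "B (R z) = z" using assms by (simp_all add: pos_inverse_def)
  then have "0 \<le> re_part (ell2_inner z (R z))" by (simp add: energy_def)
  then show ?thesis
    unfolding energy_def conjugate_ell2_inner[of z "R z", symmetric] by (simp only: re_part_conjugate)
qed

text \<open>
  The Sherman-Morrison formula: the inverse of $R + s\,yy^*$ is $B - t\,(By)(By)^*$ with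
  $t = s/(1 + s\langle By,y\rangle)$. It holds for either sign of $s$, and positivity survives as long as
  the denominator is positive. The second part says how much the form of the inverse drops, which
  is what the potential below keeps track of.
\<close>

lemma sherman_morrison:
  fixes R :: "'a::{conj_field,banach} ell2 \<Rightarrow> 'a ell2"
  assumes inv: "pos_inverse R B" and pos: "0 < 1 + s * energy B y"
  defines "t \<equiv> s / (1 + s * energy B y)"
  defines "B' \<equiv> (\<lambda>w. B w - ell2_scale (of_real t * ell2_inner w (B y)) (B y))"
  shows "pos_inverse (\<lambda>z. R z + ell2_scale (of_real s * ell2_inner z y) y) B'"
    and "energy B' x = energy B x - t * (norm (ell2_inner x (B y)))\<^sup>2"
proof -
  let ?a = "energy B y"
  interpret B: Vector_Spaces.linear ell2_scale ell2_scale B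
    using inv by (simp add: pos_inverse_def)
  have BR: "B (R z) = z" for z using inv by (simp add: pos_inverse_def)
  have herm: "ell2_inner (B v) w = ell2_inner v (B w)" for v w
    using inv by (simp add: pos_inverse_def)
  have psd: "0 \<le> energy B v" for v using inv by (simp add: pos_inverse_def)
  have conj_By: "ell2_inner (B y) v = conjugate (ell2_inner v (B y))" for v
    by (simp only: conjugate_ell2_inner)
  have a: "ell2_inner (B y) y = of_real ?a"
    unfolding energy_def
    by (rule of_real_re_part_hermitian[symmetric]) (simp only: conjugate_ell2_inner herm)
  have a': "ell2_inner y (B y) = of_real ?a" using a herm by simp
  have ts: "t * (1 + s * ?a) = s" using pos by (simp add: t_def)
  have energy': "energy B' v = energy B v - t * (norm (ell2_inner v (B y)))\<^sup>2" for v
  proof -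
    have "ell2_inner (B' v) v = ell2_inner (B v) v -
        of_real t * (ell2_inner v (B y) * conjugate (ell2_inner v (B y)))"
      by (simp only: B'_def ell2_inner_diff_left ell2_inner_scale_left conj_By mult.assoc)
    then show ?thesis
      by (simp only: energy_def re_part_diff re_part_of_real_mult re_part_mult_conjugate)
  qed
  then show "energy B' x = energy B x - t * (norm (ell2_inner x (B y)))\<^sup>2" .
  have lin': "Vector_Spaces.linear ell2_scale ell2_scale B'"
  proof unfold_locales
    show "B' (v + w) = B' v + B' w" for v w
      unfolding B'_def B.add ell2_inner_add_left distrib_left ell2.scale_left_distrib by simp
    show "B' (ell2_scale c v) = ell2_scale c (B' v)" for c v
      unfolding B'_def B.scale ell2_inner_scale_left
      by (simp add: ell2.scale_right_diff_distrib mult.left_commute)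
  qed
  have inv': "B' (R z + ell2_scale (of_real s * ell2_inner z y) y) = z" for z
  proof -
    let ?b = "ell2_inner z y"
    have "ell2_inner (R z) (B y) = ?b" using herm[of "R z" y] BR by simp
    then have "B' (R z + ell2_scale (of_real s * ?b) y) =
        z + ell2_scale (of_real s * ?b) (B y)
          - ell2_scale (of_real t * (?b + of_real s * ?b * of_real ?a)) (B y)"
      unfolding B'_def B.add B.scale BR ell2_inner_add_left ell2_inner_scale_left a' by simp
    also have "of_real t * (?b + of_real s * ?b * of_real ?a) = of_real (t * (1 + s * ?a)) * ?b"
      by (simp add: algebra_simps)
    finally show ?thesis unfolding ts by simp
  qed
  have herm': "ell2_inner (B' v) w = ell2_inner v (B' w)" for v w
    by (simp add: B'_def ell2_inner_diff_left ell2_inner_diff_right ell2_inner_scale_left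
        ell2_inner_scale_right herm conj_By conj_By[of w, unfolded herm] conjugate_mult mult_ac)
  have psd': "0 \<le> energy B' v" for v
  proof (cases "t \<le> 0")
    case True
    have "t * (norm (ell2_inner v (B y)))\<^sup>2 \<le> 0" by (rule mult_nonpos_nonneg[OF True]) simp
    then show ?thesis unfolding energy' using psd[of v] by linarith
  next
    case False
    let ?b = "ell2_inner v (B y)"
    \<comment> \<open>For $t > 0$ the vector $w = v - t\langle v,By\rangle y$ satisfies
      $\langle Bw,w\rangle \le \langle B'v,v\rangle$, so positivity of $B'$ follows from that of $B$
      without a Cauchy-Schwarz inequality for $B$.\<close>
    define w where "w = v - ell2_scale (of_real t * ?b) y"
    have Bw: "B w = B v - ell2_scale (of_real t * ?b) (B y)"
      unfolding w_def B.diff B.scale ..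
    have "ell2_inner (B w) w = ell2_inner (B v) v - of_real (2 * t - t * t * ?a) * (?b * conjugate ?b)"
      unfolding Bw
      by (simp add: w_def ell2_inner_diff_left ell2_inner_diff_right ell2_inner_scale_left
        ell2_inner_scale_right herm[of v] conj_By[of v] a conjugate_mult algebra_simps)
    then have "energy B w = energy B v - (2 * t - t * t * ?a) * (norm ?b)\<^sup>2"
      by (simp only: energy_def re_part_diff re_part_of_real_mult re_part_mult_conjugate)
    moreover have "t \<le> 2 * t - t * t * ?a"
    proof -
      have "t * ?a \<le> 1"
        using pos by (simp add: t_def field_simps)
      then have "t * (t * ?a) \<le> t * 1" by (rule mult_left_mono) (use False in simp)
      then show ?thesis by (simp add: algebra_simps)
    qed
    then have "t * (norm ?b)\<^sup>2 \<le> (2 * t - t * t * ?a) * (norm ?b)\<^sup>2"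
      by (rule mult_right_mono) simp
    ultimately show ?thesis unfolding energy' using psd[of w] by linarith
  qed
  show "pos_inverse (\<lambda>z. R z + ell2_scale (of_real s * ell2_inner z y) y) B'"
    unfolding pos_inverse_def using lin' inv' herm' psd' by blast
qed

section \<open>A partial colouring from two barriers\<close>

text \<open>
  The drop of the form of the inverse under an update by $s$ is proportional to $s/(1+sa)$, where
  $a = \langle By,y\rangle$. A random sign added to a drift $g$ produces the updates $g+1$ and $g-1$; the concavity
  of $s/(1+sa)$ costs about $a$ on average, and a drift $g \ge a$ compensates it.
\<close>

lemma balanced_shift:
  fixes a g :: real
  assumes "0 \<le> a" "a \<le> g" "0 < g"
  shows "0 < 1 + (g + 1) * a" "0 < 1 + (g - 1) * a"
    and "0 \<le> (g + 1) / (1 + (g + 1) * a) + (g - 1) / (1 + (g - 1) * a)"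
proof -
  show p1: "0 < 1 + (g + 1) * a" using assms by (simp add: add_pos_nonneg)
  show p2: "0 < 1 + (g - 1) * a"
  proof (cases "g \<ge> 1")
    case True then show ?thesis using assms by (simp add: add_pos_nonneg)
  next
    case False
    have "(1 - g) * a \<le> 1 * a" using assms False by (intro mult_right_mono) auto
    then have "(1 - g) * a < 1" using assms False by linarith
    then show ?thesis by (simp add: algebra_simps)
  qed
  have "0 \<le> g * g * a" using assms by simp
  moreover have "(g + 1) * (1 + (g - 1) * a) + (g - 1) * (1 + (g + 1) * a) = 2 * (g - a) + 2 * (g * g * a)"
    by (simp add: algebra_simps)
  moreover have "0 \<le> 2 * (g - a)" using assms by simp
  ultimately have "0 \<le> (g + 1) * (1 + (g - 1) * a) + (g - 1) * (1 + (g + 1) * a)"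
    by (simp only: add_nonneg_nonneg mult_nonneg_nonneg zero_le_numeral)
  then have "0 \<le> ((g + 1) * (1 + (g - 1) * a) + (g - 1) * (1 + (g + 1) * a)) /
      ((1 + (g + 1) * a) * (1 + (g - 1) * a))"
    using p1 p2 by simp
  also have "\<dots> = (g + 1) / (1 + (g + 1) * a) + (g - 1) / (1 + (g - 1) * a)"
    using p1 p2 by (simp add: add_frac_eq)
  finally show "0 \<le> (g + 1) / (1 + (g + 1) * a) + (g - 1) / (1 + (g - 1) * a)" .
qed

text \<open>
  Two barriers move simultaneously, one by $g - e$ and the other by $g + e$. Averaged over $e = \pm 1$,
  neither of the two potentials increases (\<open>balanced_shift\<close>), so some sign makes their sum not increase.
\<close>

lemma choose_sign:
  fixes R1 R2 :: "'a::{conj_field,banach} ell2 \<Rightarrow> 'a ell2"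
  assumes inv1: "pos_inverse R1 B1" and inv2: "pos_inverse R2 B2"
    and small: "energy B1 y \<le> g" "energy B2 y \<le> g" "0 < g"
  obtains e :: real and B1' B2' where "e = 1 \<or> e = -1"
    "pos_inverse (\<lambda>z. R1 z + ell2_scale (of_real (g - e) * ell2_inner z y) y) B1'"
    "pos_inverse (\<lambda>z. R2 z + ell2_scale (of_real (g + e) * ell2_inner z y) y) B2'"
    "(\<Sum>i\<in>I. energy B1' (x i)) + (\<Sum>i\<in>I. energy B2' (x i))
       \<le> (\<Sum>i\<in>I. energy B1 (x i)) + (\<Sum>i\<in>I. energy B2 (x i))"
proof -
  have nn: "0 \<le> energy B1 y" "0 \<le> energy B2 y"
    using inv1 inv2 by (simp_all add: pos_inverse_def)
  define T where "T B s = s / (1 + s * energy B y)" for B s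
  define U where "U B s = (\<lambda>w. B w - ell2_scale (of_real (T B s) * ell2_inner w (B y)) (B y))" for B s
  define S where "S B = (\<Sum>i\<in>I. (norm (ell2_inner (x i) (B y)))\<^sup>2)" for B
  have S: "0 \<le> S B" for B unfolding S_def by (intro sum_nonneg) simp
  note b1 = balanced_shift[OF nn(1) small(1,3)] and b2 = balanced_shift[OF nn(2) small(2,3)]
  have inv: "pos_inverse (\<lambda>z. R1 z + ell2_scale (of_real (g - e) * ell2_inner z y) y) (U B1 (g - e))"
      "pos_inverse (\<lambda>z. R2 z + ell2_scale (of_real (g + e) * ell2_inner z y) y) (U B2 (g + e))"
    and drop: "(\<Sum>i\<in>I. energy (U B1 (g - e)) (x i)) = (\<Sum>i\<in>I. energy B1 (x i)) - T B1 (g - e) * S B1"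
      "(\<Sum>i\<in>I. energy (U B2 (g + e)) (x i)) = (\<Sum>i\<in>I. energy B2 (x i)) - T B2 (g + e) * S B2"
    if "e = 1 \<or> e = -1" for e
  proof -
    have p: "0 < 1 + (g - e) * energy B1 y" "0 < 1 + (g + e) * energy B2 y"
      using that b1 b2 by auto
    show "pos_inverse (\<lambda>z. R1 z + ell2_scale (of_real (g - e) * ell2_inner z y) y) (U B1 (g - e))"
      unfolding U_def T_def by (rule sherman_morrison(1)[OF inv1 p(1)])
    show "pos_inverse (\<lambda>z. R2 z + ell2_scale (of_real (g + e) * ell2_inner z y) y) (U B2 (g + e))"
      unfolding U_def T_def by (rule sherman_morrison(1)[OF inv2 p(2)])
    show "(\<Sum>i\<in>I. energy (U B1 (g - e)) (x i)) = (\<Sum>i\<in>I. energy B1 (x i)) - T B1 (g - e) * S B1"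
      unfolding U_def T_def S_def sherman_morrison(2)[OF inv1 p(1)] sum_subtractf sum_distrib_left ..
    show "(\<Sum>i\<in>I. energy (U B2 (g + e)) (x i)) = (\<Sum>i\<in>I. energy B2 (x i)) - T B2 (g + e) * S B2"
      unfolding U_def T_def S_def sherman_morrison(2)[OF inv2 p(2)] sum_subtractf sum_distrib_left ..
  qed
  have "0 \<le> (T B1 (g + 1) + T B1 (g - 1)) * S B1" "0 \<le> (T B2 (g + 1) + T B2 (g - 1)) * S B2"
    unfolding T_def using b1(3) b2(3) S by (auto intro: mult_nonneg_nonneg)
  then have "0 \<le> (T B1 (g - 1) * S B1 + T B2 (g + 1) * S B2)
      + (T B1 (g - (- 1)) * S B1 + T B2 (g + (- 1)) * S B2)"
    by (simp add: algebra_simps)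
  then obtain e :: real where e: "e = 1 \<or> e = -1" and "0 \<le> T B1 (g - e) * S B1 + T B2 (g + e) * S B2"
    by (smt (verit))
  then show thesis using that[OF e inv(1)[OF e] inv(2)[OF e]] drop[OF e] by linarith
qed

definition barrier :: "real \<Rightarrow> 'i set \<Rightarrow> ('i \<Rightarrow> real) \<Rightarrow> ('i \<Rightarrow> 'a::conj_field ell2) \<Rightarrow> 'a ell2 \<Rightarrow> 'a ell2" where
  "barrier c I k y z = ell2_scale (of_real c) z + (\<Sum>i\<in>I. ell2_scale (of_real (k i) * ell2_inner z (y i)) (y i))"

lemma energy_barrier:
  fixes y :: "'i \<Rightarrow> 'a::{conj_field,banach} ell2"
  shows "energy (barrier c I k y) z = c * (norm z)\<^sup>2 + (\<Sum>i\<in>I. k i * (norm (ell2_inner z (y i)))\<^sup>2)"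
proof -
  have "ell2_inner (barrier c I k y z) z = of_real c * of_real ((norm z)\<^sup>2) +
      (\<Sum>i\<in>I. of_real (k i) * (ell2_inner z (y i) * conjugate (ell2_inner z (y i))))"
    unfolding barrier_def ell2_inner_add_left ell2_inner_sum_left ell2_inner_scale_left
      ell2_inner_self conjugate_ell2_inner mult.assoc ..
  then show ?thesis
    by (simp only: energy_def re_part_add re_part_sum re_part_of_real_mult re_part_mult_conjugate
        re_part_of_real)
qed

lemma barrier_update:
  fixes y :: "'i \<Rightarrow> 'a::{conj_field,banach} ell2"
  assumes "finite I" "i \<in> I" "k i = 0"
  shows "barrier c I (k(i := s)) y = (\<lambda>z. barrier c I k y z + ell2_scale (of_real s * ell2_inner z (y i)) (y i))"
  unfolding barrier_def fun_eq_iff sum.remove[OF assms(1,2)] using assms(3)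
  by (auto intro!: sum.cong simp: algebra_simps)

lemma pos_inverse_barrier_zero:
  fixes y :: "'i \<Rightarrow> 'a::{conj_field,banach} ell2"
  assumes c: "0 < c"
  shows "pos_inverse (barrier c I (\<lambda>_. 0) y) (ell2_scale (of_real (1 / c)))"
    and "energy (ell2_scale (of_real (1 / c))) x = (norm (x::'a ell2))\<^sup>2 / c"
proof -
  have e: "energy (ell2_scale (of_real (1 / c))) x = (norm x)\<^sup>2 / c" for x :: "'a ell2"
    by (simp only: energy_def ell2_inner_scale_left ell2_inner_self re_part_of_real_mult
        re_part_of_real times_divide_eq_left mult_1)
  then show "energy (ell2_scale (of_real (1 / c))) x = (norm (x::'a ell2))\<^sup>2 / c" .
  have lin: "Vector_Spaces.linear ell2_scale ell2_scale (ell2_scale (of_real (1 / c) :: 'a))"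
    by unfold_locales (simp_all add: ell2.scale_right_distrib mult.commute)
  show "pos_inverse (barrier c I (\<lambda>_. 0) y) (ell2_scale (of_real (1 / c)))"
    unfolding pos_inverse_def e using lin c
    by (simp add: barrier_def ell2_inner_scale_left ell2_inner_scale_right
        conjugate_of_real[of "1 / c", simplified] of_real_divide[symmetric] of_real_mult[symmetric]
        del: of_real_divide of_real_mult)
qed

text \<open>
  Signs are given to vectors one at a time while both operators
  $c + \sum_i (g|e_i| \mp e_i)\,y_iy_i^*$ stay positive. The potential
  $\sum_i \langle B_1y_i,y_i\rangle + \sum_i \langle B_2y_i,y_i\rangle$ starts at most at $2H/c$ and never grows. While at least half
  of the vectors are uncoloured, one of these therefore has $\langle B_1y,y\rangle + \langle B_2y,y\rangle$ at most
  $(2H/c)/(|I|/2) \le g$, and it can be coloured next. This averaging argument is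
  the reason for colouring only half of the vectors.
\<close>

lemma partial_colouring_exists:
  fixes y :: "'i \<Rightarrow> 'a::{conj_field,banach} ell2" and c g H :: real
  assumes fin: "finite I" and c: "0 < c" and g: "0 < g"
    and tr: "(\<Sum>i\<in>I. (norm (y i))\<^sup>2) \<le> H" and H: "4 * H \<le> g * c * card I"
    and k: "2 * k \<le> card I + 1"
  shows "\<exists>e :: 'i \<Rightarrow> real. (\<forall>i\<in>I. e i \<in> {-1, 0, 1}) \<and> card {i\<in>I. e i \<noteq> 0} = k \<and>
    (\<exists>B1 B2. pos_inverse (barrier c I (\<lambda>i. g * \<bar>e i\<bar> - e i) y) B1 \<and>
       pos_inverse (barrier c I (\<lambda>i. g * \<bar>e i\<bar> + e i) y) B2 \<and>
       (\<Sum>i\<in>I. energy B1 (y i)) + (\<Sum>i\<in>I. energy B2 (y i)) \<le> 2 * H / c)"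
  using k
proof (induction k)
  case 0
  let ?B = "ell2_scale (of_real (1 / c)) :: 'a ell2 \<Rightarrow> 'a ell2"
  have "(\<Sum>i\<in>I. energy ?B (y i)) = (\<Sum>i\<in>I. (norm (y i))\<^sup>2) / c"
    by (simp only: pos_inverse_barrier_zero(2)[OF c] sum_divide_distrib)
  also have "\<dots> \<le> H / c" using tr c by (simp add: divide_right_mono)
  finally have "(\<Sum>i\<in>I. energy ?B (y i)) + (\<Sum>i\<in>I. energy ?B (y i)) \<le> 2 * H / c" by simp
  moreover have "pos_inverse (barrier c I (\<lambda>i. g * \<bar>0\<bar> - 0) y) ?B" "pos_inverse (barrier c I (\<lambda>i. g * \<bar>0\<bar> + 0) y) ?B"
    using pos_inverse_barrier_zero(1)[OF c, of I y] by simp_all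
  ultimately show ?case
    by (intro exI[of _ "\<lambda>_. 0"] conjI exI[of _ ?B]) simp_all
next
  case (Suc k)
  then obtain e :: "'i \<Rightarrow> real" and B1 B2 where e: "\<And>i. i \<in> I \<Longrightarrow> e i \<in> {-1, 0, 1}"
    and card_e: "card {i\<in>I. e i \<noteq> 0} = k"
    and inv: "pos_inverse (barrier c I (\<lambda>i. g * \<bar>e i\<bar> - e i) y) B1"
       "pos_inverse (barrier c I (\<lambda>i. g * \<bar>e i\<bar> + e i) y) B2"
    and pot: "(\<Sum>i\<in>I. energy B1 (y i)) + (\<Sum>i\<in>I. energy B2 (y i)) \<le> 2 * H / c"
    by auto
  define J where "J = {i\<in>I. e i = 0}"
  have J: "J \<subseteq> I" "finite J" using fin by (auto simp: J_def)
  have "J \<union> {i\<in>I. e i \<noteq> 0} = I" "J \<inter> {i\<in>I. e i \<noteq> 0} = {}" by (auto simp: J_def)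
  then have "card I = card J + k"
    using card_Un_disjoint[OF J(2), of "{i\<in>I. e i \<noteq> 0}"] fin card_e by simp
  then have cJ: "card I \<le> 2 * card J" "0 < card J" using Suc.prems by auto
  have nn: "0 \<le> energy B1 v" "0 \<le> energy B2 v" for v
    using inv by (simp_all add: pos_inverse_def)
  have "\<exists>j\<in>J. energy B1 (y j) + energy B2 (y j) \<le> g"
  proof (rule ccontr)
    assume "\<not> (\<exists>j\<in>J. energy B1 (y j) + energy B2 (y j) \<le> g)"
    then have big: "g < energy B1 (y j) + energy B2 (y j)" if "j \<in> J" for j
      using that not_le by blast
    have "2 * H / c \<le> g * card J"
    proof -
      have "4 * H \<le> g * c * (2 * real (card J))"
        by (rule order_trans[OF H mult_left_mono]) (use g c cJ(1) in auto)
      then show ?thesis using c by (simp add: field_simps)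
    qed
    also have "\<dots> = (\<Sum>j\<in>J. g)" by simp
    also have "\<dots> < (\<Sum>j\<in>J. energy B1 (y j) + energy B2 (y j))"
      by (rule sum_strict_mono) (use big J cJ in auto)
    also have "\<dots> \<le> (\<Sum>i\<in>I. energy B1 (y i) + energy B2 (y i))"
      by (rule sum_mono2) (use fin J nn in auto)
    finally show False using pot by (simp add: sum.distrib)
  qed
  then obtain j where j: "j \<in> J" and small: "energy B1 (y j) + energy B2 (y j) \<le> g" by blast
  have jI: "j \<in> I" and ej: "e j = 0" using j by (auto simp: J_def)
  have "energy B1 (y j) \<le> g" "energy B2 (y j) \<le> g"
    using small nn[of "y j"] by linarith+
  from choose_sign[OF inv this g, where x = y and I = I] obtain s :: real and B1' B2' where s: "s = 1 \<or> s = -1"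
    and inv': "pos_inverse (\<lambda>z. barrier c I (\<lambda>i. g * \<bar>e i\<bar> - e i) y z +
        ell2_scale (of_real (g - s) * ell2_inner z (y j)) (y j)) B1'"
      "pos_inverse (\<lambda>z. barrier c I (\<lambda>i. g * \<bar>e i\<bar> + e i) y z +
        ell2_scale (of_real (g + s) * ell2_inner z (y j)) (y j)) B2'"
    and pot': "(\<Sum>i\<in>I. energy B1' (y i)) + (\<Sum>i\<in>I. energy B2' (y i))
       \<le> (\<Sum>i\<in>I. energy B1 (y i)) + (\<Sum>i\<in>I. energy B2 (y i))"
    by blast
  define e' where "e' = e(j := s)"
  have upd: "(\<lambda>i. g * \<bar>e' i\<bar> - e' i) = (\<lambda>i. g * \<bar>e i\<bar> - e i)(j := g - s)"
     "(\<lambda>i. g * \<bar>e' i\<bar> + e' i) = (\<lambda>i. g * \<bar>e i\<bar> + e i)(j := g + s)"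
    using s by (auto simp: e'_def fun_eq_iff)
  have "{i\<in>I. e' i \<noteq> 0} = insert j {i\<in>I. e i \<noteq> 0}"
    using s jI by (auto simp: e'_def)
  then have "card {i\<in>I. e' i \<noteq> 0} = Suc k"
    using fin ej card_e by simp
  moreover have "\<forall>i\<in>I. e' i \<in> {-1, 0, 1}" using e s by (auto simp: e'_def)
  moreover have "pos_inverse (barrier c I (\<lambda>i. g * \<bar>e' i\<bar> - e' i) y) B1'"
      "pos_inverse (barrier c I (\<lambda>i. g * \<bar>e' i\<bar> + e' i) y) B2'"
    unfolding upd using inv' ej by (simp_all add: barrier_update[OF fin jI])
  ultimately show ?case using pot pot' by (intro exI[of _ e'] conjI exI[of _ B1'] exI[of _ B2']) auto
qed

text \<open>
  Positivity of both barriers is the two-sided discrepancy bound. The bound is symmetric in the signs,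
  so the colouring may be negated, and then at least half of the coloured vectors, that is a quarter of all,
  carry the sign $-1$.
\<close>

lemma partial_colouring:
  fixes y :: "'i \<Rightarrow> 'a::{conj_field,banach} ell2" and c g :: real
  assumes fin: "finite I" and c: "0 < c" and g: "0 < g"
    and tr: "4 * (\<Sum>i\<in>I. (norm (y i))\<^sup>2) \<le> g * c * card I"
  obtains e :: "'i \<Rightarrow> real" where "\<And>i. i \<in> I \<Longrightarrow> e i \<in> {-1, 0, 1}"
    "card I \<le> 4 * card {i\<in>I. e i = -1}"
    "\<And>z. \<bar>\<Sum>i\<in>I. e i * (norm (ell2_inner z (y i)))\<^sup>2\<bar>
       \<le> c * (norm z)\<^sup>2 + g * (\<Sum>i\<in>I. (norm (ell2_inner z (y i)))\<^sup>2)"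
proof -
  obtain e :: "'i \<Rightarrow> real" and B1 B2 where e: "\<And>i. i \<in> I \<Longrightarrow> e i \<in> {-1, 0, 1}"
    and card_e: "card {i\<in>I. e i \<noteq> 0} = (card I + 1) div 2"
    and inv: "pos_inverse (barrier c I (\<lambda>i. g * \<bar>e i\<bar> - e i) y) B1"
       "pos_inverse (barrier c I (\<lambda>i. g * \<bar>e i\<bar> + e i) y) B2"
    using partial_colouring_exists[OF fin c g order_refl tr, of "(card I + 1) div 2"] by auto
  have bound: "\<bar>\<Sum>i\<in>I. e i * (norm (ell2_inner z (y i)))\<^sup>2\<bar>
       \<le> c * (norm z)\<^sup>2 + g * (\<Sum>i\<in>I. (norm (ell2_inner z (y i)))\<^sup>2)" for z
  proof -
    let ?q = "\<lambda>i. (norm (ell2_inner z (y i)))\<^sup>2"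
    have "(\<Sum>i\<in>I. g * \<bar>e i\<bar> * ?q i) \<le> (\<Sum>i\<in>I. g * ?q i)"
      using e g by (intro sum_mono mult_right_mono) fastforce+
    moreover have "0 \<le> c * (norm z)\<^sup>2 + (\<Sum>i\<in>I. (g * \<bar>e i\<bar> - e i) * ?q i)"
      "0 \<le> c * (norm z)\<^sup>2 + (\<Sum>i\<in>I. (g * \<bar>e i\<bar> + e i) * ?q i)"
      using energy_nonneg_of_pos_inverse[OF inv(1), of z] energy_nonneg_of_pos_inverse[OF inv(2), of z]
      unfolding energy_barrier .
    ultimately show ?thesis
      by (simp add: left_diff_distrib distrib_right sum.distrib sum_subtractf sum_distrib_left)
  qed
  let ?P = "{i\<in>I. e i = 1}" and ?N = "{i\<in>I. e i = -1}"
  have "{i\<in>I. e i \<noteq> 0} = ?P \<union> ?N" "?P \<inter> ?N = {}" using e by fastforce+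
  then have "card {i\<in>I. e i \<noteq> 0} = card ?P + card ?N"
    using card_Un_disjoint[of ?P ?N] fin by auto
  then have half: "card I \<le> 2 * card ?P + 2 * card ?N" using card_e by linarith
  show thesis
  proof (cases "card ?P \<le> card ?N")
    case True
    then show thesis using half by (intro that[of e] e bound) auto
  next
    case False
    have "{i\<in>I. - e i = - 1} = ?P" by auto
    moreover have "- e i \<in> {-1, 0, 1}" if "i \<in> I" for i using e[OF that] by auto
    ultimately show thesis using half False bound
      by (intro that[of "\<lambda>i. - e i"]) (auto simp: sum_negf)
  qed
qed

section \<open>Thinning the weights\<close>

text \<open>
  The quadratic form of $\sum_i w_i\, x_ix_i^*$.
\<close>

definition wform :: "'i set \<Rightarrow> ('i \<Rightarrow> 'a::conj_field ell2) \<Rightarrow> ('i \<Rightarrow> real) \<Rightarrow> 'a ell2 \<Rightarrow> real" where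
  "wform J x w z = (\<Sum>i\<in>J. w i * (norm (ell2_inner z (x i)))\<^sup>2)"

text \<open>
  With a partial colouring \<open>e\<close> of the vectors $\sqrt{w_i}\,x_i$, the weights $w_i(1+e_i)$ are still nonnegative,
  vanish where $e_i = -1$, and change the form by a discrepancy of size $\sqrt{H/m}$ when $m$ weights are
  nonzero.
\<close>

lemma thin_support:
  fixes x :: "'i \<Rightarrow> 'a::{conj_field,banach} ell2" and w :: "'i \<Rightarrow> real"
  assumes fin: "finite J" and w: "\<And>i. i \<in> J \<Longrightarrow> 0 \<le> w i"
    and K: "\<And>z. wform J x w z \<le> K * (norm z)\<^sup>2"
    and H: "(\<Sum>i\<in>J. w i * (norm (x i))\<^sup>2) \<le> H" "0 < H"
    and m: "0 < card {i\<in>J. w i \<noteq> 0}"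
  obtains w' :: "'i \<Rightarrow> real" where "\<And>i. i \<in> J \<Longrightarrow> 0 \<le> w' i"
    "4 * card {i\<in>J. w' i \<noteq> 0} \<le> 3 * card {i\<in>J. w i \<noteq> 0}"
    "\<And>z. \<bar>wform J x w' z - wform J x w z\<bar>
       \<le> 2 * (1 + K) * sqrt (H / card {i\<in>J. w i \<noteq> 0}) * (norm z)\<^sup>2"
proof -
  define I where "I = {i\<in>J. w i \<noteq> 0}"
  \<comment> \<open>The level of the barriers and their drift both contribute to the discrepancy and only their product
    is constrained; they are taken equal, with $g^2|I| = 4H$.\<close>
  define g where "g = 2 * sqrt (H / card I)"
  define y where "y i = ell2_scale (of_real (sqrt (w i))) (x i)" for i
  have finI: "finite I" and IJ: "I \<subseteq> J" using fin by (auto simp: I_def)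
  have cI: "0 < card I" using m by (simp add: I_def)
  have g: "0 < g" using H(2) cI by (simp add: g_def)
  have y2: "(norm (y i))\<^sup>2 = w i * (norm (x i))\<^sup>2" if "i \<in> J" for i
    using w[OF that] by (simp add: y_def norm_ell2_scale power_mult_distrib)
  have iy2: "(norm (ell2_inner z (y i)))\<^sup>2 = w i * (norm (ell2_inner z (x i)))\<^sup>2" if "i \<in> J" for i z
    using w[OF that] by (simp add: y_def ell2_inner_scale_right norm_mult power_mult_distrib)
  have to_I: "(\<Sum>i\<in>J. w i * f i) = (\<Sum>i\<in>I. w i * f i)" for f :: "'i \<Rightarrow> real"
    by (rule sum.mono_neutral_right) (use fin in \<open>auto simp: I_def\<close>)
  have "(\<Sum>i\<in>I. (norm (y i))\<^sup>2) \<le> H"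
    using H(1) unfolding to_I using y2 IJ by (simp add: subset_iff)
  moreover have "g * g * card I = 4 * H"
    using H(2) cI by (simp add: g_def field_simps)
  ultimately have "4 * (\<Sum>i\<in>I. (norm (y i))\<^sup>2) \<le> g * g * card I" by simp
  from partial_colouring[OF finI g g this] obtain e :: "'i \<Rightarrow> real" where
    e: "\<And>i. i \<in> I \<Longrightarrow> e i \<in> {-1, 0, 1}" and neg: "card I \<le> 4 * card {i\<in>I. e i = -1}"
    and disc: "\<And>z. \<bar>\<Sum>i\<in>I. e i * (norm (ell2_inner z (y i)))\<^sup>2\<bar>
       \<le> g * (norm z)\<^sup>2 + g * (\<Sum>i\<in>I. (norm (ell2_inner z (y i)))\<^sup>2)" by blast
  define w' where "w' i = w i * (1 + e i)" for i
  have "0 \<le> w' i" if "i \<in> J" for i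
  proof (cases "i \<in> I")
    case True
    then show ?thesis using e[OF True] w[OF that] by (auto simp: w'_def)
  next
    case False
    then show ?thesis using that by (simp add: w'_def I_def)
  qed
  moreover have "4 * card {i\<in>J. w' i \<noteq> 0} \<le> 3 * card I"
  proof -
    have "{i\<in>J. w' i \<noteq> 0} \<subseteq> I - {i\<in>I. e i = -1}" by (auto simp: w'_def I_def)
    then have "card {i\<in>J. w' i \<noteq> 0} \<le> card (I - {i\<in>I. e i = -1})"
      by (rule card_mono[rotated]) (use finI in simp)
    also have "\<dots> = card I - card {i\<in>I. e i = -1}"
      by (rule card_Diff_subset) (use finI in auto)
    finally show ?thesis using neg by linarith
  qed
  moreover have "\<bar>wform J x w' z - wform J x w z\<bar> \<le> 2 * (1 + K) * sqrt (H / card I) * (norm z)\<^sup>2" for z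
  proof -
    have wf: "(\<Sum>i\<in>I. (norm (ell2_inner z (y i)))\<^sup>2) = wform J x w z"
      unfolding wform_def to_I using iy2 IJ by (intro sum.cong) auto
    have "wform J x w' z - wform J x w z = (\<Sum>i\<in>J. w i * (e i * (norm (ell2_inner z (x i)))\<^sup>2))"
      unfolding wform_def sum_subtractf[symmetric] by (intro sum.cong) (simp_all add: w'_def algebra_simps)
    also have "\<dots> = (\<Sum>i\<in>I. e i * (norm (ell2_inner z (y i)))\<^sup>2)"
      unfolding to_I using iy2 IJ by (intro sum.cong) auto
    finally have "\<bar>wform J x w' z - wform J x w z\<bar> \<le> g * (norm z)\<^sup>2 + g * wform J x w z"
      using disc[of z] wf by simp
    also have "\<dots> \<le> g * (norm z)\<^sup>2 + g * (K * (norm z)\<^sup>2)"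
      using K[of z] g by (intro add_left_mono mult_left_mono) auto
    finally show ?thesis by (simp add: g_def algebra_simps)
  qed
  ultimately show thesis using that[of w'] unfolding I_def by blast
qed

text \<open>
  Each round multiplies the support by at most $3/4$, so the errors $\sqrt{H/m}$ of the rounds grow geometrically and
  the last one dominates. The total error must stay bounded by a constant, here $2$, because the
  discrepancy of a round depends on the norm of the current form. The constant $75$ absorbs an error $10d$ per round since
  $75\sqrt{3/4} \le 65$.
\<close>

lemma iterated_thinning:
  fixes x :: "'i \<Rightarrow> 'a::{conj_field,banach} ell2" and k :: nat
  assumes fin: "finite J"
    and one: "\<And>z. wform J x (\<lambda>_. 1) z \<le> 2 * (norm z)\<^sup>2"
    and tr: "\<And>w. (\<And>i. i \<in> J \<Longrightarrow> 0 \<le> w i) \<Longrightarrow> (\<And>z. wform J x w z \<le> 4 * (norm z)\<^sup>2)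
      \<Longrightarrow> (\<Sum>i\<in>J. w i * (norm (x i))\<^sup>2) \<le> H"
    and H: "0 < H" and N: "0 < card J"
    and small: "75 * sqrt (H / ((3/4) ^ k * card J)) \<le> 2"
  shows "\<exists>w. (\<forall>i\<in>J. 0 \<le> w i) \<and> card {i\<in>J. w i \<noteq> 0} \<le> (3/4) ^ k * card J \<and>
    (\<forall>z. \<bar>wform J x w z - wform J x (\<lambda>_. 1) z\<bar>
       \<le> 75 * sqrt (H / ((3/4) ^ k * card J)) * (norm z)\<^sup>2)"
  using small
proof (induction k)
  case 0
  show ?case using H by (intro exI[of _ "\<lambda>_. 1"]) auto
next
  case (Suc k)
  define m where "m = (3/4) ^ k * real (card J)"
  define d where "d = sqrt (H / (3/4 * m))"
  have m: "0 < m" using N by (simp add: m_def)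
  have mS: "(3/4) ^ Suc k * real (card J) = 3/4 * m" by (simp add: m_def)
  have d: "0 \<le> d" "75 * d \<le> 2"
    using Suc.prems H m unfolding mS d_def by simp_all
  have dk: "75 * sqrt (H / m) \<le> 65 * d"
  proof -
    \<comment> \<open>$(13/15)^2 \ge 3/4$, and $75 \cdot 13/15 = 65$.\<close>
    have "H / m = 3/4 * (H / (3/4 * m))" by simp
    also have "\<dots> \<le> (13/15)\<^sup>2 * (H / (3/4 * m))"
      using H m by (intro mult_right_mono) (simp_all add: power2_eq_square)
    finally have "sqrt (H / m) \<le> sqrt ((13/15)\<^sup>2 * (H / (3/4 * m)))" by (rule real_sqrt_le_mono)
    also have "\<dots> = 13/15 * d" unfolding d_def real_sqrt_mult by simp
    finally show ?thesis by simp
  qed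
  have "75 * sqrt (H / ((3/4) ^ k * card J)) \<le> 2" using dk d unfolding m_def by linarith
  from Suc.IH[OF this] obtain w where w: "\<And>i. i \<in> J \<Longrightarrow> 0 \<le> w i"
    and supp: "card {i\<in>J. w i \<noteq> 0} \<le> m"
    and dev: "\<And>z. \<bar>wform J x w z - wform J x (\<lambda>_. 1) z\<bar> \<le> 75 * sqrt (H / m) * (norm z)\<^sup>2"
    unfolding m_def by blast
  have dev': "\<bar>wform J x w z - wform J x (\<lambda>_. 1) z\<bar> \<le> 65 * d * (norm z)\<^sup>2" for z
    by (rule order_trans[OF dev]) (intro mult_right_mono dk, simp)
  show ?case
  proof (cases "card {i\<in>J. w i \<noteq> 0} \<le> 3/4 * m")
    case True
    have "\<bar>wform J x w z - wform J x (\<lambda>_. 1) z\<bar> \<le> 75 * d * (norm z)\<^sup>2" for z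
      by (rule order_trans[OF dev']) (intro mult_right_mono, use d in auto)
    then show ?thesis using True w unfolding mS d_def by blast
  next
    case False
    let ?c = "card {i\<in>J. w i \<noteq> 0}"
    have c: "3/4 * m < ?c" "0 < ?c" using False m by (auto intro!: Nat.gr0I)
    have K: "wform J x w z \<le> 4 * (norm z)\<^sup>2" for z
    proof -
      have "65 * d * (norm z)\<^sup>2 \<le> 2 * (norm z)\<^sup>2" using d by (intro mult_right_mono) auto
      then show ?thesis using dev'[of z] one[of z] by linarith
    qed
    obtain w' where w': "\<And>i. i \<in> J \<Longrightarrow> 0 \<le> w' i"
      and supp': "4 * card {i\<in>J. w' i \<noteq> 0} \<le> 3 * ?c"
      and step: "\<And>z. \<bar>wform J x w' z - wform J x w z\<bar> \<le> 2 * (1 + 4) * sqrt (H / ?c) * (norm z)\<^sup>2"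
      using thin_support[OF fin w K tr[OF w K] H c(2)] by blast
    have "real (card {i\<in>J. w' i \<noteq> 0}) \<le> 3/4 * m" using supp' supp by linarith
    moreover have "\<bar>wform J x w' z - wform J x (\<lambda>_. 1) z\<bar> \<le> 75 * d * (norm z)\<^sup>2" for z
    proof -
      have "sqrt (H / ?c) \<le> d"
        unfolding d_def using H m c by (intro real_sqrt_le_mono divide_left_mono) auto
      then have "2 * (1 + 4) * sqrt (H / ?c) * (norm z)\<^sup>2 \<le> 10 * d * (norm z)\<^sup>2"
        by (intro mult_right_mono) auto
      then have "\<bar>wform J x w' z - wform J x (\<lambda>_. 1) z\<bar> \<le> 10 * d * (norm z)\<^sup>2 + 65 * d * (norm z)\<^sup>2"
        using step[of z] dev'[of z] by linarith
      then show ?thesis by (simp add: algebra_simps)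
    qed
    ultimately show ?thesis using w' unfolding mS d_def by blast
  qed
qed

text \<open>
  The rounds stop at the first $k$ with $(3/4)^k|J| \le n$; by minimality this number is still larger than
  $3n/4$, so the error is of order $\sqrt{H/n}$.
\<close>

lemma sparse_weights_trace_controlled:
  fixes x :: "'i \<Rightarrow> 'a::{conj_field,banach} ell2" and n :: nat
  assumes fin: "finite J"
    and one: "\<And>z. wform J x (\<lambda>_. 1) z \<le> 2 * (norm z)\<^sup>2"
    and tr: "\<And>w. (\<And>i. i \<in> J \<Longrightarrow> 0 \<le> w i) \<Longrightarrow> (\<And>z. wform J x w z \<le> 4 * (norm z)\<^sup>2)
      \<Longrightarrow> (\<Sum>i\<in>J. w i * (norm (x i))\<^sup>2) \<le> H"
    and H: "0 < H" and n: "0 < n" and small: "100 * sqrt (H / n) \<le> 2"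
  obtains w where "card {i\<in>J. w i \<noteq> 0} \<le> n"
    "\<And>z. \<bar>wform J x w z - wform J x (\<lambda>_. 1) z\<bar> \<le> 100 * sqrt (H / n) * (norm z)\<^sup>2"
proof (cases "card J \<le> n")
  case True
  then show thesis using H by (intro that[of "\<lambda>_. 1"]) auto
next
  case False
  define m where "m k = (3/4) ^ k * real (card J)" for k
  have N: "0 < card J" using False by simp
  obtain k0 where "(3/4 :: real) ^ k0 < n / card J"
    using real_arch_pow_inv[of "real n / card J" "3/4"] n N by auto
  then have ex: "m k0 \<le> n" using N by (simp add: m_def field_simps)
  define k where "k = (LEAST k. m k \<le> n)"
  have k: "m k \<le> n" unfolding k_def using ex by (rule LeastI)
  have "k \<noteq> 0"
  proof
    assume "k = 0"
    then show False using k False by (simp add: m_def)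
  qed
  then obtain j where j: "k = Suc j" using not0_implies_Suc by blast
  have "\<not> m j \<le> n" using not_less_Least[of j "\<lambda>k. m k \<le> n"] j unfolding k_def by simp
  then have lower: "3/4 * n < m k" by (simp add: j m_def)
  have "75 * sqrt (H / m k) \<le> 75 * sqrt ((4/3)\<^sup>2 * (H / n))"
  proof (intro mult_left_mono real_sqrt_le_mono)
    have "H / m k \<le> H / (3/4 * n)" using H lower n by (intro divide_left_mono) auto
    also have "\<dots> = 4/3 * (H / n)" by simp
    also have "\<dots> \<le> (4/3)\<^sup>2 * (H / n)" using H by (intro mult_right_mono) (auto simp: power2_eq_square)
    finally show "H / m k \<le> (4/3)\<^sup>2 * (H / n)" .
  qed simp
  also have "\<dots> = 100 * sqrt (H / n)" unfolding real_sqrt_mult by simp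
  finally have le: "75 * sqrt (H / m k) \<le> 100 * sqrt (H / n)" .
  have "75 * sqrt (H / ((3/4) ^ k * card J)) \<le> 2" using le small unfolding m_def by linarith
  from iterated_thinning[OF fin one tr H N this] obtain w where
    w: "card {i\<in>J. w i \<noteq> 0} \<le> m k"
    "\<And>z. \<bar>wform J x w z - wform J x (\<lambda>_. 1) z\<bar> \<le> 75 * sqrt (H / m k) * (norm z)\<^sup>2"
    unfolding m_def by blast
  show thesis
  proof (rule that[of w])
    show "card {i\<in>J. w i \<noteq> 0} \<le> n" using w(1) k by linarith
    show "\<bar>wform J x w z - wform J x (\<lambda>_. 1) z\<bar> \<le> 100 * sqrt (H / n) * (norm z)\<^sup>2" for z
      by (rule order_trans[OF w(2)]) (intro mult_right_mono le, simp)
  qed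
qed

section \<open>Control of the trace by an extra coordinate\<close>

text \<open>
  Prepending a coordinate realises the direct sum with the scalar field inside \<open>ell2\<close> itself.
\<close>

lift_definition ell2_cons :: "'a::real_normed_vector \<Rightarrow> 'a ell2 \<Rightarrow> 'a ell2" is "\<lambda>c x. case_nat c x"
  by (subst summable_Suc_iff[symmetric]) simp

lift_definition ell2_tail :: "'a::real_normed_vector ell2 \<Rightarrow> 'a ell2" is "\<lambda>x i. x (Suc i)"
  by (subst summable_Suc_iff)

lemma ell2_cons_tail: "ell2_cons (entry z 0) (ell2_tail z) = z"
  by (rule ell2_eqI) (simp add: ell2_cons.rep_eq ell2_tail.rep_eq split: nat.split)

lemma norm_ell2_cons: "(norm (ell2_cons c x))\<^sup>2 = (norm c)\<^sup>2 + (norm x)\<^sup>2"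
  using suminf_split_head[OF summable_entry[of "ell2_cons c x"]]
  by (simp add: norm_ell2_sq ell2_cons.rep_eq)

lemma ell2_inner_cons:
  "ell2_inner (ell2_cons c x) (ell2_cons d y) = c * conjugate d + ell2_inner x (y::'a::{conj_field,banach} ell2)"
  using suminf_split_head[OF summable_ell2_inner[of "ell2_cons c x" "ell2_cons d y"]]
  by (simp add: ell2_inner_rep ell2_cons.rep_eq)

text \<open>
  The rounds of thinning need a bound on $\sum_i w_i\|x_i\|^2$ for all intermediate weights, while the discrepancy
  bound controls only the form. Prepending the coordinate $\|x_i\|/\sqrt h$ to $x_i$ makes this trace visible to
  the form: it is $h$ times the value of the extended form at the first basis vector. The extended form
  has norm at most $2$ for unit weights, and restricting to vectors with first coordinate $0$ gives
  back the original form.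
\<close>

lemma sparse_weights:
  fixes x :: "'i \<Rightarrow> 'a::{conj_field,banach} ell2" and n :: nat
  assumes fin: "finite J"
    and one: "\<And>z. wform J x (\<lambda>_. 1) z \<le> (norm z)\<^sup>2"
    and tr: "(\<Sum>i\<in>J. (norm (x i))\<^sup>2) \<le> h" and h: "1 \<le> h"
    and n: "0 < n" and small: "300 * sqrt (h / n) \<le> 2"
  obtains w where "card {i\<in>J. w i \<noteq> 0} \<le> n"
    "\<And>z. \<bar>wform J x w z - wform J x (\<lambda>_. 1) z\<bar> \<le> 300 * sqrt (h / n) * (norm z)\<^sup>2"
proof -
  define r where "r i = norm (x i) / sqrt h" for i
  define x' where "x' i = ell2_cons (of_real (r i)) (x i)" for i
  have r2: "(r i)\<^sup>2 = (norm (x i))\<^sup>2 / h" for i using h by (simp add: r_def power_divide)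
  have inner': "ell2_inner (ell2_cons c z) (x' i) = c * of_real (r i) + ell2_inner z (x i)" for c z i
    by (simp add: x'_def ell2_inner_cons)
  have one': "wform J x' (\<lambda>_. 1) z \<le> 2 * (norm z)\<^sup>2" for z
  proof -
    define c t where "c = entry z 0" and "t = ell2_tail z"
    have z: "z = ell2_cons c t" by (simp add: c_def t_def ell2_cons_tail)
    have sq: "(norm (c * of_real (r i) + ell2_inner t (x i)))\<^sup>2
        \<le> 2 * ((norm c)\<^sup>2 * ((norm (x i))\<^sup>2 / h)) + 2 * (norm (ell2_inner t (x i)))\<^sup>2" for i
    proof -
      have "(norm (c * of_real (r i) + ell2_inner t (x i)))\<^sup>2
          \<le> (norm c * \<bar>r i\<bar> + norm (ell2_inner t (x i)))\<^sup>2"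
        by (intro power_mono order_trans[OF norm_triangle_ineq]) (simp_all add: norm_mult)
      also have "\<dots> \<le> 2 * (norm c * \<bar>r i\<bar>)\<^sup>2 + 2 * (norm (ell2_inner t (x i)))\<^sup>2"
        using sum_squares_bound[of "norm c * \<bar>r i\<bar>" "norm (ell2_inner t (x i))"] by (simp add: power2_sum)
      finally show ?thesis by (simp add: power_mult_distrib r2)
    qed
    have "wform J x' (\<lambda>_. 1) z
        \<le> (\<Sum>i\<in>J. 2 * ((norm c)\<^sup>2 * ((norm (x i))\<^sup>2 / h)) + 2 * (norm (ell2_inner t (x i)))\<^sup>2)"
      unfolding wform_def z inner' mult_1 by (intro sum_mono sq)
    also have "\<dots> = 2 * ((norm c)\<^sup>2 * ((\<Sum>i\<in>J. (norm (x i))\<^sup>2) / h)) + 2 * wform J x (\<lambda>_. 1) t"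
      by (simp add: sum.distrib wform_def sum_distrib_left sum_divide_distrib)
    also have "\<dots> \<le> 2 * ((norm c)\<^sup>2 * 1) + 2 * (norm t)\<^sup>2"
      using tr h one[of t] by (intro add_mono mult_left_mono) (auto simp: field_simps)
    also have "\<dots> = 2 * (norm z)\<^sup>2" by (simp add: z norm_ell2_cons)
    finally show ?thesis .
  qed
  have tr': "(\<Sum>i\<in>J. w i * (norm (x' i))\<^sup>2) \<le> 8 * h"
    if w: "\<And>i. i \<in> J \<Longrightarrow> 0 \<le> w i" and K: "\<And>z. wform J x' w z \<le> 4 * (norm z)\<^sup>2" for w
  proof -
    have "wform J x' w (ell2_cons 1 0) = (\<Sum>i\<in>J. w i * (norm (x i))\<^sup>2) / h"
      unfolding wform_def inner' by (simp add: r2 sum_divide_distrib)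
    moreover have "wform J x' w (ell2_cons 1 0) \<le> 4" using K[of "ell2_cons 1 0"] by (simp add: norm_ell2_cons)
    ultimately have "(\<Sum>i\<in>J. w i * (norm (x i))\<^sup>2) / h \<le> 4" by linarith
    then have "(\<Sum>i\<in>J. w i * (norm (x i))\<^sup>2) \<le> 4 * h"
      using h by (simp add: divide_le_eq)
    moreover have "w i * (norm (x' i))\<^sup>2 \<le> 2 * (w i * (norm (x i))\<^sup>2)" if "i \<in> J" for i
    proof -
      have "(norm (x i))\<^sup>2 / h \<le> (norm (x i))\<^sup>2 / 1" using h by (intro divide_left_mono) auto
      then have "(norm (x' i))\<^sup>2 \<le> 2 * (norm (x i))\<^sup>2"
        by (simp add: x'_def norm_ell2_cons r2)
      then show ?thesis using mult_left_mono[OF _ w[OF that]] by fastforce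
    qed
    then have "(\<Sum>i\<in>J. w i * (norm (x' i))\<^sup>2) \<le> 2 * (\<Sum>i\<in>J. w i * (norm (x i))\<^sup>2)"
      unfolding sum_distrib_left by (rule sum_mono)
    ultimately show ?thesis by linarith
  qed
  have "100 * sqrt (8 * h / n) \<le> 100 * sqrt (3\<^sup>2 * (h / n))"
    using h by (intro mult_left_mono real_sqrt_le_mono) (auto intro!: divide_right_mono)
  also have "\<dots> = 300 * sqrt (h / n)" unfolding real_sqrt_mult by simp
  finally have le: "100 * sqrt (8 * h / n) \<le> 300 * sqrt (h / n)" .
  have small': "100 * sqrt (8 * h / n) \<le> 2" and h': "0 < 8 * h" using le small h by linarith+
  obtain w where w: "card {i\<in>J. w i \<noteq> 0} \<le> n"
    "\<And>z. \<bar>wform J x' w z - wform J x' (\<lambda>_. 1) z\<bar> \<le> 100 * sqrt (8 * h / n) * (norm z)\<^sup>2"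
    by (rule sparse_weights_trace_controlled[OF fin one' tr' h' n small']) blast+
  show thesis
  proof (rule that[OF w(1)])
    fix z
    have restrict: "wform J x' v (ell2_cons 0 z) = wform J x v z" for v
      unfolding wform_def inner' by simp
    have "\<bar>wform J x w z - wform J x (\<lambda>_. 1) z\<bar> \<le> 100 * sqrt (8 * h / n) * (norm z)\<^sup>2"
      using w(2)[of "ell2_cons 0 z"] unfolding restrict norm_ell2_cons by simp
    also have "\<dots> \<le> 300 * sqrt (h / n) * (norm z)\<^sup>2" by (intro mult_right_mono le) simp
    finally show "\<bar>wform J x w z - wform J x (\<lambda>_. 1) z\<bar> \<le> 300 * sqrt (h / n) * (norm z)\<^sup>2" .
  qed
qed

section \<open>Adjoints, diagonal operators and norms\<close>

lemma norm_entry_le: "norm (entry x j) \<le> norm x"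
  using sum_entry_le[of "{j}" x] by (simp add: power2_le_iff_abs_le)

text \<open>
  For a Hilbert-Schmidt operator the adjoint is written down explicitly, with coordinates
  $\langle y, ue_j\rangle$; they are square-summable because $\sum_j \|ue_j\|^2 < \infty$.
\<close>

lemma adjoint_hilbert_schmidt:
  fixes u :: "'a::{conj_field,banach} ell2 \<Rightarrow> 'a ell2"
  assumes u: "bounded_op u" and hs: "hilbert_schmidt u"
  shows "ell2_inner (u x) y = ell2_inner x (ell2_adjoint u y)"
    and "entry (ell2_adjoint u y) j = ell2_inner y (u (ell2_basis j))"
proof -
  interpret u: Vector_Spaces.linear ell2_scale ell2_scale u
    using u by (simp add: bounded_op_def)
  define v where "v z = Abs_ell2 (\<lambda>j. ell2_inner z (u (ell2_basis j)))" for z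
  have summ: "summable (\<lambda>j. (norm (ell2_inner z (u (ell2_basis j))))\<^sup>2)" for z
  proof (rule summable_comparison_test')
    show "summable (\<lambda>j. (norm z)\<^sup>2 * (norm (u (ell2_basis j)))\<^sup>2)"
      using hs by (simp add: hilbert_schmidt_def summable_mult)
    show "norm ((norm (ell2_inner z (u (ell2_basis j))))\<^sup>2) \<le> (norm z)\<^sup>2 * (norm (u (ell2_basis j)))\<^sup>2" for j
      by (simp add: power_mult_distrib[symmetric] power_mono norm_ell2_inner_le)
  qed
  have v: "entry (v z) j = ell2_inner z (u (ell2_basis j))" for z j
    unfolding v_def by (subst Abs_ell2_inverse) (use summ in auto)
  have adj: "ell2_inner (u x) y = ell2_inner x (v y)" for x y
  proof -
    have "bounded_linear (\<lambda>z. ell2_inner z y)"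
    proof (rule bounded_linear_intro[of _ "norm y"])
      show "ell2_inner (r *\<^sub>R z) y = r *\<^sub>R ell2_inner z y" for r z
      proof -
        have "r *\<^sub>R z = ell2_scale (of_real r) z" by transfer (simp add: scaleR_conv_of_real)
        then show ?thesis by (simp add: ell2_inner_scale_left scaleR_conv_of_real)
      qed
    qed (simp_all add: ell2_inner_add_left norm_ell2_inner_le)
    from bounded_linear_compose[OF this bounded_op_imp_bounded_linear[OF u]]
    have "(\<lambda>n. ell2_inner (u (\<Sum>j<n. ell2_scale (entry x j) (ell2_basis j))) y) \<longlonglongrightarrow> ell2_inner (u x) y"
      by (rule bounded_linear.tendsto[OF _ truncation_tendsto])
    moreover have "ell2_inner (u (\<Sum>j<n. ell2_scale (entry x j) (ell2_basis j))) y
        = (\<Sum>j<n. entry x j * conjugate (entry (v y) j))" for n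
      by (simp add: u.sum u.scale ell2_inner_sum_left ell2_inner_scale_left v conjugate_ell2_inner)
    moreover have "(\<lambda>n. \<Sum>j<n. entry x j * conjugate (entry (v y) j)) \<longlonglongrightarrow> ell2_inner x (v y)"
      unfolding ell2_inner_rep by (rule summable_LIMSEQ[OF summable_ell2_inner])
    ultimately show ?thesis using LIMSEQ_unique by simp
  qed
  have "ell2_adjoint u = v"
    unfolding ell2_adjoint_def
  proof (rule the_equality)
    show "\<forall>x y. ell2_inner (u x) y = ell2_inner x (v y)" using adj by blast
    fix v' assume v': "\<forall>x y. ell2_inner (u x) y = ell2_inner x (v' y)"
    show "v' = v"
    proof (intro ext ell2_eqI)
      fix z i
      have "ell2_inner (ell2_basis i) (v' z) = ell2_inner (ell2_basis i) (v z)" using v' adj by metis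
      then have "conjugate (conjugate (entry (v' z) i)) = conjugate (conjugate (entry (v z) i))"
        by (simp only: ell2_inner_basis_left)
      then show "entry (v' z) i = entry (v z) i" by simp
    qed
  qed
  then show "ell2_inner (u x) y = ell2_inner x (ell2_adjoint u y)"
    "entry (ell2_adjoint u y) j = ell2_inner y (u (ell2_basis j))"
    using adj v by simp_all
qed

lemma norm_sq_eq_re_inner: "(norm x)\<^sup>2 = re_part (ell2_inner x (x::'a::{conj_field,banach} ell2))"
  unfolding ell2_inner_self by (rule re_part_of_real[symmetric])

lemma re_part_le_norm: "re_part c \<le> norm (c::'a::conj_field)"
proof -
  have "norm (of_real (2 * re_part c) :: 'a) \<le> norm c + norm c"
    unfolding of_real_re_part using norm_triangle_ineq[of c "conjugate c"] by simp
  then show ?thesis by (simp only: norm_of_real)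
qed

text \<open>
  The norm of a Hermitian operator is bounded by its quadratic form: polarization and the
  parallelogram law, applied to $x$ and to $Tx$ rescaled to the length of $x$. Additivity of $T$ is
  derived from the symmetry.
\<close>

lemma norm_le_of_energy_le:
  fixes T :: "'a::{conj_field,banach} ell2 \<Rightarrow> 'a ell2"
  assumes herm: "\<And>x y. ell2_inner (T x) y = ell2_inner x (T y)"
    and le: "\<And>x. \<bar>energy T x\<bar> \<le> \<epsilon> * (norm x)\<^sup>2"
  shows "norm (T x) \<le> \<epsilon> * norm x"
proof (cases "T x = 0 \<or> x = 0")
  case True
  have "0 \<le> \<epsilon> * norm x"
  proof (cases "x = 0")
    case False
    have "0 \<le> \<epsilon> * (norm x)\<^sup>2" using le[of x] by linarith
    then show ?thesis using False by (simp add: zero_le_mult_iff)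
  qed simp
  moreover have "T 0 = 0"
  proof -
    have "ell2_inner (T 0) (T 0) = 0" using herm[of 0 "T 0"] by simp
    then have "(norm (T 0))\<^sup>2 = 0" unfolding norm_sq_eq_re_inner by simp
    then show ?thesis by simp
  qed
  ultimately show ?thesis using True by auto
next
  case False
  define s where "s = norm x / norm (T x)"
  define y where "y = ell2_scale (of_real s) (T x)"
  have s: "0 \<le> s" "s * norm (T x) = norm x" using False by (simp_all add: s_def)
  have ny: "norm y = norm x" using s by (simp add: y_def norm_ell2_scale)
  have add: "ell2_inner (T (v + w)) z = ell2_inner (T v) z + ell2_inner (T w) z"
    and diff: "ell2_inner (T (v - w)) z = ell2_inner (T v) z - ell2_inner (T w) z" for v w z
    by (simp_all only: herm ell2_inner_add_left ell2_inner_diff_left)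
  have sym: "re_part (ell2_inner (T y) x) = re_part (ell2_inner (T x) y)"
    using re_part_conjugate[of "ell2_inner (T x) y"] by (simp only: conjugate_ell2_inner herm[of y x])
  have "re_part (ell2_inner (T x) y) = s * (norm (T x))\<^sup>2"
    unfolding y_def norm_sq_eq_re_inner
    by (simp only: ell2_inner_scale_right conjugate_of_real re_part_of_real_mult)
  then have "4 * (norm x * norm (T x)) = 4 * re_part (ell2_inner (T x) y)"
    using s(2) by (simp add: power2_eq_square mult.assoc[symmetric])
  also have "\<dots> = energy T (x + y) - energy T (x - y)"
    using sym by (simp add: energy_def add diff ell2_inner_add_right ell2_inner_diff_right re_part_add re_part_diff)
  also have "\<dots> \<le> \<epsilon> * (norm (x + y))\<^sup>2 + \<epsilon> * (norm (x - y))\<^sup>2"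
    using le[of "x + y"] le[of "x - y"] by linarith
  also have "\<dots> = \<epsilon> * (2 * (norm x)\<^sup>2 + 2 * (norm y)\<^sup>2)"
    unfolding norm_sq_eq_re_inner
    by (simp add: ell2_inner_add_left ell2_inner_add_right ell2_inner_diff_left ell2_inner_diff_right
        re_part_add re_part_diff algebra_simps)
  finally have "norm x * norm (T x) \<le> norm x * (\<epsilon> * norm x)"
    unfolding ny by (simp add: power2_eq_square algebra_simps)
  then show ?thesis using False by simp
qed

definition diag_op :: "nat set \<Rightarrow> (nat \<Rightarrow> real) \<Rightarrow> 'a::conj_field ell2 \<Rightarrow> 'a ell2" where
  "diag_op S w x = (\<Sum>j\<in>S. ell2_scale (of_real (w j) * entry x j) (ell2_basis j))"

lemma entry_diag_op:
  "finite S \<Longrightarrow> entry (diag_op S w x) j = of_real (if j \<in> S then w j else 0) * entry x j"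
proof -
  assume S: "finite S"
  have "entry (diag_op S w x) j = (\<Sum>i\<in>S. if i = j then of_real (w i) * entry x i else 0)"
    unfolding diag_op_def entry_sum by (intro sum.cong) (auto simp: ell2_scale.rep_eq entry_basis)
  then show ?thesis using S by (simp add: sum.delta)
qed

lemma linear_diag_op: "finite S \<Longrightarrow> Vector_Spaces.linear ell2_scale ell2_scale (diag_op S w)"
  by unfold_locales (auto intro!: ell2_eqI simp: entry_diag_op plus_ell2.rep_eq ell2_scale.rep_eq algebra_simps)

lemma diag_op_basis: "finite S \<Longrightarrow> diag_op S w (ell2_basis j) = ell2_scale (of_real (if j \<in> S then w j else 0)) (ell2_basis j)"
  by (rule ell2_eqI) (auto simp: entry_diag_op ell2_scale.rep_eq entry_basis)

lemma diagonal_op_diag_op: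
  assumes "finite S"
  shows "diagonal_op (diag_op S w :: 'a::conj_field ell2 \<Rightarrow> 'a ell2)"
proof -
  have "norm (diag_op S w x) \<le> (\<Sum>j\<in>S. \<bar>w j\<bar>) * norm x" for x :: "'a ell2"
  proof -
    have "norm (ell2_basis j :: 'a ell2) \<le> 1" for j
    proof -
      have "(norm (ell2_basis j :: 'a ell2))\<^sup>2 = (\<Sum>i\<in>{j}. (norm (entry (ell2_basis j :: 'a ell2) i))\<^sup>2)"
        unfolding norm_ell2_sq by (rule suminf_finite) (auto simp: entry_basis)
      then show ?thesis by (simp add: entry_basis power2_le_imp_le)
    qed
    then have "norm (ell2_scale (of_real (w j) * entry x j) (ell2_basis j)) \<le> \<bar>w j\<bar> * norm x * 1" for j
      unfolding norm_ell2_scale norm_mult norm_of_real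
      by (intro mult_mono mult_left_mono norm_entry_le) auto
    then have "norm (diag_op S w x) \<le> (\<Sum>j\<in>S. \<bar>w j\<bar> * norm x * 1)"
      unfolding diag_op_def by (intro sum_norm_le)
    then show ?thesis by (simp add: sum_distrib_right)
  qed
  then have "bounded_op (diag_op S w :: 'a ell2 \<Rightarrow> 'a ell2)"
    unfolding bounded_op_def using linear_diag_op[OF assms] by blast
  then show ?thesis unfolding diagonal_op_def using diag_op_basis[OF assms] by blast
qed

lemma op_rank_diag_op_le:
  assumes S: "finite S" and w: "\<And>j. j \<in> S \<Longrightarrow> w j \<noteq> 0"
  shows "op_rank (diag_op S w :: 'a::conj_field ell2 \<Rightarrow> 'a ell2) \<le> enat (card S)"
proof -
  let ?D = "diag_op S w :: 'a ell2 \<Rightarrow> 'a ell2" and ?E = "ell2_basis ` S :: 'a ell2 set"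
  interpret D: Vector_Spaces.linear ell2_scale ell2_scale ?D by (rule linear_diag_op[OF S])
  have "ell2.span ?E = range ?D"
  proof
    show "range ?D \<subseteq> ell2.span ?E"
    proof (rule image_subsetI)
      show "?D x \<in> ell2.span ?E" for x
        unfolding diag_op_def by (rule ell2.span_sum) (rule ell2.span_scale, rule ell2.span_base, rule imageI)
    qed
    show "ell2.span ?E \<subseteq> range ?D"
    proof (rule ell2.span_minimal)
      show "?E \<subseteq> range ?D"
      proof
        fix b assume "b \<in> ?E"
        then obtain j where j: "j \<in> S" "b = ell2_basis j" by blast
        have "b = ?D (ell2_scale (of_real (1 / w j)) (ell2_basis j))"
          using j w[OF j(1)] by (simp add: D.scale diag_op_basis[OF S])
        then show "b \<in> range ?D" by blast
      qed
      show "ell2.subspace (range ?D)" by (rule D.subspace_image[OF ell2.subspace_UNIV])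
    qed
  qed
  then have span: "\<exists>B. finite B \<and> ell2.span B = range ?D" and "range ?D \<subseteq> ell2.span ?E"
    using S by (blast, simp)
  then have "ell2.dim (range ?D) \<le> card ?E"
    by (intro ell2.dim_le_card finite_imageI S)
  also have "\<dots> \<le> card S" by (rule card_image_le[OF S])
  finally show ?thesis unfolding op_rank_def if_P[OF span] by simp
qed

text \<open>
  The quadratic form of $u(\Delta - \mathrm{id})u^*$ at $z$ is the weighted sum of the
  $|\langle z, ue_j\rangle|^2$ with weights $w_j - 1$, and $w_j - 1 = -1$ outside \<open>S\<close>.
\<close>

lemma norm_compression_le:
  fixes u :: "'a::{conj_field,banach} ell2 \<Rightarrow> 'a ell2"
  assumes u: "bounded_op u" "hilbert_schmidt u" and S: "finite S"
    and le: "\<And>z. \<bar>\<Sum>j. ((if j \<in> S then w j else 0) - 1) * (norm (ell2_inner z (u (ell2_basis j))))\<^sup>2\<bar> \<le> \<epsilon> * (norm z)\<^sup>2"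
    and \<epsilon>: "0 \<le> \<epsilon>"
  shows "onorm (u \<circ> (\<lambda>x. diag_op S w x - id x) \<circ> ell2_adjoint u) \<le> \<epsilon>"
proof (rule onorm_bound[OF \<epsilon>])
  define d where "d j = (if j \<in> S then w j else 0) - 1" for j
  define D where "D x = diag_op S w x - id x" for x :: "'a ell2"
  let ?v = "ell2_adjoint u" and ?T = "u \<circ> D \<circ> ell2_adjoint u"
  note adj = adjoint_hilbert_schmidt[OF u]
  have D: "entry (D x) j = of_real (d j) * entry x j" for x j
    by (simp add: D_def minus_ell2.rep_eq entry_diag_op[OF S] d_def algebra_simps)
  have D_sym: "ell2_inner (D x) y = ell2_inner x (D y)" for x y
    unfolding ell2_inner_rep D by (simp add: conjugate_mult mult_ac)
  have T: "ell2_inner (?T x) y = ell2_inner (D (?v x)) (?v y)" for x y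
    by (simp add: adj(1))
  have T_sym: "ell2_inner (?T x) y = ell2_inner x (?T y)" for x y
    unfolding T D_sym
    using arg_cong[OF T[of y x], of conjugate] by (simp only: conjugate_ell2_inner)
  have "energy ?T z = (\<Sum>j. d j * (norm (ell2_inner z (u (ell2_basis j))))\<^sup>2)" for z
  proof -
    have summ: "summable (\<lambda>j. d j * (norm (entry (?v z) j))\<^sup>2)"
    proof (rule summable_comparison_test')
      show "summable (\<lambda>j. ((\<Sum>i\<in>S. \<bar>w i\<bar>) + 1) * (norm (entry (?v z) j))\<^sup>2)"
        by (intro summable_mult summable_entry)
      have "\<bar>d j\<bar> \<le> (\<Sum>i\<in>S. \<bar>w i\<bar>) + 1" for j
        using member_le_sum[of j S "\<lambda>i. \<bar>w i\<bar>"] S sum_nonneg[of S "\<lambda>i. \<bar>w i\<bar>"] by (auto simp: d_def)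
      then show "norm (d j * (norm (entry (?v z) j))\<^sup>2) \<le> ((\<Sum>i\<in>S. \<bar>w i\<bar>) + 1) * (norm (entry (?v z) j))\<^sup>2" for j
        by (simp add: abs_mult mult_right_mono)
    qed
    have "ell2_inner (?T z) z = (\<Sum>j. of_real (d j * (norm (entry (?v z) j))\<^sup>2))"
      unfolding T unfolding ell2_inner_rep D
      by (simp only: mult.assoc mult_conjugate_of_real of_real_mult)
    also have "\<dots> = of_real (\<Sum>j. d j * (norm (entry (?v z) j))\<^sup>2)"
      by (rule suminf_of_real[OF summ, symmetric])
    finally show ?thesis unfolding energy_def adj(2) by (simp only: re_part_of_real)
  qed
  then have "\<bar>energy ?T z\<bar> \<le> \<epsilon> * (norm z)\<^sup>2" for z
    using le[of z] unfolding d_def by simp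
  from norm_le_of_energy_le[OF T_sym this]
  show "norm ((u \<circ> (\<lambda>x. diag_op S w x - id x) \<circ> ell2_adjoint u) x) \<le> \<epsilon> * norm x" for x
    unfolding D_def[abs_def] .
qed

section \<open>Sparse diagonal approximation of the identity\<close>

text \<open>
  If $300\sqrt{h/n} > 2$, the zero operator will do, since $\|uu^*\| \le 1$. Otherwise all but finitely many of the vectors
  $ue_j$ are dropped at a cost of at most $\sqrt{h/n}$, because their tail in $h = \sum_j \|ue_j\|^2$ is small, and the
  finitely many others are thinned out.
\<close>

lemma diagonal_sparsification:
  fixes u :: "'a::{conj_field,banach} ell2 \<Rightarrow> 'a ell2" and n :: nat
  assumes u: "bounded_op u" "onorm u = 1" "hilbert_schmidt u"
    and h: "h = (hs_norm u)\<^sup>2" and n: "0 < n"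
  shows "\<exists>\<Delta>. diagonal_op \<Delta> \<and> op_rank \<Delta> \<le> enat n \<and>
     onorm (u \<circ> (\<lambda>x. \<Delta> x - id x) \<circ> ell2_adjoint u) \<le> 301 * sqrt (h / n)"
proof -
  let ?x = "\<lambda>j. u (ell2_basis j)" and ?v = "ell2_adjoint u"
  note adj = adjoint_hilbert_schmidt[OF u(1,3)]
  have summ: "summable (\<lambda>j. (norm (?x j))\<^sup>2)" using u(3) by (simp add: hilbert_schmidt_def)
  have h_sum: "h = (\<Sum>j. (norm (?x j))\<^sup>2)"
    unfolding h hs_norm_def by (simp add: suminf_nonneg[OF summ])
  then have h0: "0 \<le> h" by (simp add: suminf_nonneg[OF summ])
  have coef: "summable (\<lambda>j. (norm (ell2_inner z (?x j)))\<^sup>2)"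
    "(norm (?v z))\<^sup>2 = (\<Sum>j. (norm (ell2_inner z (?x j)))\<^sup>2)" for z
    using summable_entry[of "?v z"] norm_ell2_sq[of "?v z"] unfolding adj(2) by simp_all
  have coef_le: "(norm (ell2_inner z (?x j)))\<^sup>2 \<le> (norm z)\<^sup>2 * (norm (?x j))\<^sup>2" for z j
    by (simp add: power_mult_distrib[symmetric] power_mono norm_ell2_inner_le)
  have norm_u: "norm (u z) \<le> norm z" for z
    using onorm[OF bounded_op_imp_bounded_linear[OF u(1)], of z] u(2) by simp
  have norm_v: "norm (?v z) \<le> norm z" for z
  proof -
    \<comment> \<open>$\|u^*z\|^2 = \langle uu^*z, z\rangle \le \|u^*z\|\,\|z\|$\<close>
    have "(norm (?v z))\<^sup>2 = re_part (ell2_inner (u (?v z)) z)"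
      unfolding norm_sq_eq_re_inner adj(1) ..
    also have "\<dots> \<le> norm (u (?v z)) * norm z"
      by (rule order_trans[OF re_part_le_norm norm_ell2_inner_le])
    also have "\<dots> \<le> norm (?v z) * norm z" by (intro mult_right_mono norm_u) simp
    finally show ?thesis by (cases "?v z = 0") (simp_all add: power2_eq_square)
  qed
  have norm_v': "norm (?v z) \<le> sqrt h * norm z" for z
  proof -
    have "(norm (?v z))\<^sup>2 \<le> (\<Sum>j. (norm z)\<^sup>2 * (norm (?x j))\<^sup>2)"
      unfolding coef(2) by (intro suminf_le coef_le coef(1) summable_mult summ)
    also have "\<dots> = (norm z)\<^sup>2 * h" unfolding h_sum by (rule suminf_mult[OF summ])
    also have "\<dots> = (sqrt h * norm z)\<^sup>2" using h0 by (simp add: power_mult_distrib)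
    finally show ?thesis by (rule power2_le_imp_le) (use h0 in simp)
  qed
  \<comment> \<open>The operator norm is at most the Hilbert-Schmidt norm, which gives $h \ge 1$.\<close>
  have "norm (u z) \<le> sqrt h * norm z" for z
  proof -
    have "(norm (u z))\<^sup>2 = re_part (ell2_inner z (?v (u z)))"
      unfolding norm_sq_eq_re_inner adj(1) ..
    also have "\<dots> \<le> norm z * norm (?v (u z))"
      by (rule order_trans[OF re_part_le_norm norm_ell2_inner_le])
    also have "\<dots> \<le> norm z * (sqrt h * norm (u z))" by (intro mult_left_mono norm_v') simp
    finally show ?thesis by (cases "u z = 0") (use h0 in \<open>simp_all add: power2_eq_square mult_ac\<close>)
  qed
  then have "onorm u \<le> sqrt h" by (intro onorm_bound) (use h0 in auto)
  then have h1: "1 \<le> h" using u(2) by simp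
  define \<epsilon> where "\<epsilon> = sqrt (h / n)"
  have \<epsilon>: "0 < \<epsilon>" using h1 n by (simp add: \<epsilon>_def)
  have parseval_le: "(\<Sum>j. (norm (ell2_inner z (?x j)))\<^sup>2) \<le> (norm z)\<^sup>2" for z
    unfolding coef(2)[symmetric] by (intro power_mono norm_v) simp
  have "\<exists>S w. finite S \<and> card S \<le> n \<and> (\<forall>j\<in>S. w j \<noteq> 0) \<and>
     (\<forall>z. \<bar>\<Sum>j. ((if j \<in> S then w j else 0) - 1) * (norm (ell2_inner z (?x j)))\<^sup>2\<bar> \<le> 301 * \<epsilon> * (norm z)\<^sup>2)"
  proof (cases "300 * \<epsilon> \<le> 2")
    case False
    have "\<bar>\<Sum>j. ((if j \<in> {} then w j else 0) - 1) * (norm (ell2_inner z (?x j)))\<^sup>2\<bar> \<le> 301 * \<epsilon> * (norm z)\<^sup>2"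
      for z and w :: "nat \<Rightarrow> real"
    proof -
      have "\<bar>\<Sum>j. ((if j \<in> {} then w j else 0) - 1) * (norm (ell2_inner z (?x j)))\<^sup>2\<bar>
          = (\<Sum>j. (norm (ell2_inner z (?x j)))\<^sup>2)"
        by (simp add: suminf_minus[OF coef(1)] suminf_nonneg[OF coef(1)])
      also have "\<dots> \<le> 1 * (norm z)\<^sup>2" using parseval_le by simp
      also have "\<dots> \<le> 301 * \<epsilon> * (norm z)\<^sup>2" using False by (intro mult_right_mono) auto
      finally show ?thesis .
    qed
    then show ?thesis
      by (intro exI[of _ "{}"] exI[of _ "\<lambda>_. 0"] conjI allI) (simp_all only: finite.emptyI card.empty ball_simps le0)
  next
    case True
    have "(\<lambda>N. \<Sum>j. (norm (?x (j + N)))\<^sup>2) \<longlonglongrightarrow> 0" by (rule suminf_exist_split2[OF summ])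
    then have "\<forall>\<^sub>F N in sequentially. (\<Sum>j. (norm (?x (j + N)))\<^sup>2) < \<epsilon>"
      using \<epsilon> by (rule order_tendstoD)
    then obtain N where N: "(\<Sum>j. (norm (?x (j + N)))\<^sup>2) < \<epsilon>"
      unfolding eventually_sequentially by blast
    have one: "wform {..<N} ?x (\<lambda>_. 1) z \<le> (norm z)\<^sup>2" for z
      unfolding wform_def mult_1
      by (rule order_trans[OF sum_le_suminf[OF coef(1)] parseval_le]) auto
    have tr: "(\<Sum>j<N. (norm (?x j))\<^sup>2) \<le> h"
      unfolding h_sum by (rule sum_le_suminf[OF summ]) auto
    obtain w where w: "card {j\<in>{..<N}. w j \<noteq> 0} \<le> n"
      and dev: "\<And>z. \<bar>wform {..<N} ?x w z - wform {..<N} ?x (\<lambda>_. 1) z\<bar> \<le> 300 * \<epsilon> * (norm z)\<^sup>2"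
      by (rule sparse_weights[OF finite_lessThan one tr h1 n True[unfolded \<epsilon>_def], folded \<epsilon>_def])
        (rule that)
    define S where "S = {j\<in>{..<N}. w j \<noteq> 0}"
    have "\<bar>\<Sum>j. ((if j \<in> S then w j else 0) - 1) * (norm (ell2_inner z (?x j)))\<^sup>2\<bar> \<le> 301 * \<epsilon> * (norm z)\<^sup>2" for z
    proof -
      let ?q = "\<lambda>j. (norm (ell2_inner z (?x j)))\<^sup>2"
      let ?f = "\<lambda>j. ((if j \<in> S then w j else 0) - 1) * ?q j"
      have shift: "?f (j + N) = - ?q (j + N)" for j by (simp add: S_def)
      have sq: "summable (\<lambda>j. ?q (j + N))" by (rule summable_ignore_initial_segment[OF coef(1)])
      have "summable (\<lambda>j. ?f (j + N))" unfolding shift using sq by (rule summable_minus)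
      then have "summable ?f" using summable_iff_shift[of ?f N] by (rule rev_iffD1)
      from suminf_split_initial_segment[OF this, of N]
      have "suminf ?f = (\<Sum>j. ?f (j + N)) + (\<Sum>j<N. ?f j)" .
      also have "(\<Sum>j. ?f (j + N)) = - (\<Sum>j. ?q (j + N))"
        unfolding shift by (rule suminf_minus[OF sq])
      also have "(\<Sum>j<N. ?f j) = wform {..<N} ?x w z - wform {..<N} ?x (\<lambda>_. 1) z"
        unfolding wform_def sum_subtractf[symmetric]
        by (intro sum.cong) (auto simp: S_def algebra_simps)
      finally have split: "suminf ?f = - (\<Sum>j. ?q (j + N)) +
        (wform {..<N} ?x w z - wform {..<N} ?x (\<lambda>_. 1) z)" .
      have "(\<Sum>j. ?q (j + N)) \<le> (\<Sum>j. (norm z)\<^sup>2 * (norm (?x (j + N)))\<^sup>2)"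
        by (intro suminf_le coef_le sq summable_mult summable_ignore_initial_segment[OF summ])
      also have "\<dots> = (norm z)\<^sup>2 * (\<Sum>j. (norm (?x (j + N)))\<^sup>2)"
        by (rule suminf_mult[OF summable_ignore_initial_segment[OF summ]])
      also have "\<dots> \<le> (norm z)\<^sup>2 * \<epsilon>" using N by (intro mult_left_mono) auto
      finally have "(\<Sum>j. ?q (j + N)) \<le> \<epsilon> * (norm z)\<^sup>2" by (simp add: mult.commute)
      moreover have "0 \<le> (\<Sum>j. ?q (j + N))" by (rule suminf_nonneg[OF sq]) simp
      ultimately have "\<bar>suminf ?f\<bar> \<le> \<epsilon> * (norm z)\<^sup>2 + 300 * \<epsilon> * (norm z)\<^sup>2"
        unfolding split using dev[of z] by linarith
      then show ?thesis by (simp add: algebra_simps)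
    qed
    moreover have "finite S" "\<forall>j\<in>S. w j \<noteq> 0" by (auto simp: S_def)
    moreover have "card S \<le> n" using w unfolding S_def .
    ultimately show ?thesis by (intro exI[of _ S] exI[of _ w] conjI allI)
  qed
  then obtain S w where S: "finite S" "card S \<le> n" "\<And>j. j \<in> S \<Longrightarrow> w j \<noteq> 0"
    and bound: "\<And>z. \<bar>\<Sum>j. ((if j \<in> S then w j else 0) - 1) * (norm (ell2_inner z (?x j)))\<^sup>2\<bar>
      \<le> 301 * \<epsilon> * (norm z)\<^sup>2"
    by blast
  have "op_rank (diag_op S w :: 'a ell2 \<Rightarrow> 'a ell2) \<le> enat n"
    by (rule order_trans[OF op_rank_diag_op_le[OF S(1), of w]]) (use S(2,3) in auto)
  moreover have "onorm (u \<circ> (\<lambda>x. diag_op S w x - id x) \<circ> ?v) \<le> 301 * \<epsilon>"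
    by (rule norm_compression_le[OF u(1,3) S(1) bound]) (use \<epsilon> in auto)
  ultimately show ?thesis
    unfolding \<epsilon>_def by (intro exI[of _ "diag_op S w"] conjI diagonal_op_diag_op[OF S(1)])
qed

lemma diagonal_sparsification_log:
  fixes u :: "'a::{conj_field,banach} ell2 \<Rightarrow> 'a ell2" and n :: nat
  assumes u: "bounded_op u" "onorm u = 1" "hilbert_schmidt u"
    and h: "h = (hs_norm u)\<^sup>2" and n: "1 < n"
  shows "\<exists>\<Delta>. diagonal_op \<Delta> \<and> op_rank \<Delta> \<le> enat n \<and>
     onorm (u \<circ> (\<lambda>x. \<Delta> x - id x) \<circ> ell2_adjoint u) \<le> 602 * sqrt (ln (real n)) * sqrt (h / real n)"
proof -
  have "1 / 4 \<le> ln (2::real)" using ln2_ge_two_thirds by simp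
  also have "\<dots> \<le> ln (real n)" using n by simp
  finally have "sqrt (1 / 4) \<le> sqrt (ln (real n))" by (rule real_sqrt_le_mono)
  then have "1 \<le> 2 * sqrt (ln (real n))" by (simp add: real_sqrt_divide)
  then have "1 * (301 * sqrt (h / real n)) \<le> 2 * sqrt (ln (real n)) * (301 * sqrt (h / real n))"
    by (rule mult_right_mono) (simp add: h)
  then have "301 * sqrt (h / real n) \<le> 602 * sqrt (ln (real n)) * sqrt (h / real n)" by simp
  moreover have "0 < n" using n by simp
  ultimately show ?thesis
    using diagonal_sparsification[OF u h] by (meson order_trans)
qed

theorem theorem3p1:
  shows "\<exists>C::real. C > 0 \<and>
    (\<forall>(u :: real ell2 \<Rightarrow> real ell2) h.
       bounded_op u \<and> onorm u = 1 \<and> hilbert_schmidt u \<and> h = (hs_norm u)\<^sup>2 \<longrightarrow>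
       (\<forall>n::nat. n > 1 \<longrightarrow>
         (\<exists>\<Delta>. diagonal_op \<Delta> \<and> op_rank \<Delta> \<le> enat n \<and>
           onorm (u \<circ> (\<lambda>x. \<Delta> x - id x) \<circ> ell2_adjoint u)
             \<le> C * sqrt (ln (real n)) * sqrt (h / real n)))) \<and>
    (\<forall>(u :: complex ell2 \<Rightarrow> complex ell2) h.
       bounded_op u \<and> onorm u = 1 \<and> hilbert_schmidt u \<and> h = (hs_norm u)\<^sup>2 \<longrightarrow>
       (\<forall>n::nat. n > 1 \<longrightarrow>
         (\<exists>\<Delta>. diagonal_op \<Delta> \<and> op_rank \<Delta> \<le> enat n \<and>
           onorm (u \<circ> (\<lambda>x. \<Delta> x - id x) \<circ> ell2_adjoint u)
             \<le> C * sqrt (ln (real n)) * sqrt (h / real n))))"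
proof (intro exI[of _ 602] conjI allI impI)
  fix u :: "real ell2 \<Rightarrow> real ell2" and h n
  assume "bounded_op u \<and> onorm u = 1 \<and> hilbert_schmidt u \<and> h = (hs_norm u)\<^sup>2" "1 < (n::nat)"
  then show "\<exists>\<Delta>. diagonal_op \<Delta> \<and> op_rank \<Delta> \<le> enat n \<and>
      onorm (u \<circ> (\<lambda>x. \<Delta> x - id x) \<circ> ell2_adjoint u) \<le> 602 * sqrt (ln (real n)) * sqrt (h / real n)"
    by (elim conjE) (rule diagonal_sparsification_log)
next
  fix u :: "complex ell2 \<Rightarrow> complex ell2" and h n
  assume "bounded_op u \<and> onorm u = 1 \<and> hilbert_schmidt u \<and> h = (hs_norm u)\<^sup>2" "1 < (n::nat)"
  then show "\<exists>\<Delta>. diagonal_op \<Delta> \<and> op_rank \<Delta> \<le> enat n \<and>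
      onorm (u \<circ> (\<lambda>x. \<Delta> x - id x) \<circ> ell2_adjoint u) \<le> 602 * sqrt (ln (real n)) * sqrt (h / real n)"
    by (elim conjE) (rule diagonal_sparsification_log)
qed simp

end
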